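(* Let $n$ be a positive odd integer, and for $k\geqslant 0$ let $$c_q(k)=(-1)^k[4k+1]\frac{(q;q^2)_k^4(q^2;q^4)_k}{(q^2;q^2)_k^4(q^4;q^4)_k}q^k.$$ Then, modulo $[n]\Phi_n(q)^2$, $$\sum_{k=0}^{n-1}\sum_{j=0}^{k}c_q(j)c_q(k-j)\equiv \begin{cases} [n]^2\dfrac{(q^2;q^4)_{(n-1)/4}^4}{(q^4;q^4)_{(n-1)/4}^4} & \text{if } n\equiv 1\pmod 4,\\[10pt] 0 & \text{if } n\equiv 3\pmod 4. \end{cases}$$
   Context: Here $q$ is an indeterminate. The $q$-shifted factorial is $(x;q)_0=1$ and $(x;q)_m=(1-x)(1-xq)\cdots(1-xq^{m-1})$ for $m\geqslant1$; the $q$-integer is $[m]=1+q+\cdots+q^{m-1}$. $\Phi_n(q)$ is the $n$-th cyclotomic polynomial. For rational functions $A,B$ in $q$ and a polynomial $P$, $A\equiv B\pmod{P}$ means that $A-B=P\cdot U/V$ for polynomials $U,V$ with $V$ coprime to $P$. *)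

theory Defs
  imports Complex_Main "HOL-Computational_Algebra.Computational_Algebra"
begin

section \<open>q-shifted factorials and q-integers\<close>

definition qpoch :: "'a::comm_ring_1 \<Rightarrow> 'a \<Rightarrow> nat \<Rightarrow> 'a"
  where "qpoch x q m = (\<Prod>i<m. 1 - x * q ^ i)"

definition qint :: "'a::comm_ring_1 \<Rightarrow> nat \<Rightarrow> 'a"
  where "qint q m = (\<Sum>i<m. q ^ i)"


section \<open>Cyclotomic polynomials\<close>

definition primitive_roots_unity :: "nat \<Rightarrow> complex set"
  where "primitive_roots_unity n = {z. z ^ n = 1 \<and> (\<forall>m. 0 < m \<and> m < n \<longrightarrow> z ^ m \<noteq> 1)}"

text \<open>
  The product over the primitive roots of unity is a complex polynomial; \<open>cyclotomic n\<close> is that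
  product regarded as a polynomial over the rationals. The description is meaningful for all
  \<open>n > 0\<close>: see \<open>of_rat_cyclotomic\<close> below.
\<close>
definition cyclotomic :: "nat \<Rightarrow> rat poly"
  where "cyclotomic n =
    (THE p. map_poly of_rat p = (\<Prod>z\<in>primitive_roots_unity n. [:- z, 1:]))"

lemma map_poly_of_rat_inj:
  assumes "map_poly of_rat p = (map_poly of_rat r :: complex poly)"
  shows "p = r"
proof (rule poly_eqI)
  fix i
  from assms have "coeff (map_poly of_rat p :: complex poly) i = coeff (map_poly of_rat r) i"
    by simp
  then show "coeff p i = coeff r i" by (simp add: coeff_map_poly)
qed

lemma map_poly_of_rat_add:
  "(map_poly of_rat (p + r) :: complex poly) = map_poly of_rat p + map_poly of_rat r"
  by (rule poly_eqI) (simp add: coeff_map_poly of_rat_add)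

lemma map_poly_of_rat_mult:
  "(map_poly of_rat (p * r) :: complex poly) = map_poly of_rat p * map_poly of_rat r"
  by (rule poly_eqI) (simp add: coeff_map_poly coeff_mult of_rat_sum of_rat_mult)

lemma map_poly_of_rat_prod:
  "(map_poly of_rat (\<Prod>i\<in>A. f i) :: complex poly) = (\<Prod>i\<in>A. map_poly of_rat (f i))"
  by (induction A rule: infinite_finite_induct) (simp_all add: map_poly_of_rat_mult)

lemma finite_primitive_roots_unity:
  assumes "n > 0"
  shows "finite (primitive_roots_unity n)"
  by (rule finite_subset[of _ "{z::complex. z ^ n = 1}"])
     (use assms in \<open>auto simp: primitive_roots_unity_def intro!: finite_roots_unity\<close>)

lemma power_minus_1_eq_prod_roots_unity:
  assumes "n > 0"
  shows "monom 1 n - 1 = (\<Prod>z\<in>{z::complex. z ^ n = 1}. [:- z, 1:])"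
proof (rule poly_eqI_degree_lead_coeff)
  have fin: "finite {z::complex. z ^ n = 1}"
    using assms by (intro finite_roots_unity) auto
  have card: "card {z::complex. z ^ n = 1} = n"
    using assms by (intro card_roots_unity_eq)
  have deg: "degree (\<Prod>z\<in>{z::complex. z ^ n = 1}. [:- z, 1:]) = n"
    by (subst degree_prod_eq_sum_degree) (auto simp: card)
  show "degree (monom 1 n - 1 :: complex poly) \<le> n"
    by (intro degree_diff_le) (auto simp: degree_monom_le)
  show "degree (\<Prod>z\<in>{z::complex. z ^ n = 1}. [:- z, 1:]) \<le> n"
    using deg by simp
  have "lead_coeff (\<Prod>z\<in>{z::complex. z ^ n = 1}. [:- z, 1:]) = 1"
    by (simp add: lead_coeff_prod)
  then show "coeff (monom 1 n - 1 :: complex poly) n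
      = coeff (\<Prod>z\<in>{z::complex. z ^ n = 1}. [:- z, 1:]) n"
    using deg assms by simp
  show "card {z::complex. z ^ n = 1} \<ge> n" using card by simp
  show "poly (monom 1 n - 1) z = poly (\<Prod>z\<in>{z::complex. z ^ n = 1}. [:- z, 1:]) z"
    if "z \<in> {z. z ^ n = 1}" for z :: complex
    using that fin by (auto simp: poly_monom poly_prod)
qed

lemma roots_unity_eq_Union_primitive:
  assumes "n > 0"
  shows "{z::complex. z ^ n = 1} = (\<Union>d\<in>{d. d dvd n}. primitive_roots_unity d)"
proof (intro equalityI subsetI)
  fix z :: complex
  assume "z \<in> {z. z ^ n = 1}"
  then have z: "z ^ n = 1" by simp
  define d where "d = (LEAST m. 0 < m \<and> z ^ m = 1)"
  have d: "0 < d \<and> z ^ d = 1"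
    unfolding d_def by (rule LeastI[of _ n]) (use z assms in auto)
  have least: "z ^ m \<noteq> 1" if "0 < m" "m < d" for m
    using not_less_Least[of m "\<lambda>m. 0 < m \<and> z ^ m = 1"] that by (auto simp: d_def)
  have "z ^ n = z ^ (d * (n div d) + n mod d)" by simp
  also have "\<dots> = z ^ (n mod d)" using d by (simp only: power_add power_mult) simp
  finally have "z ^ (n mod d) = 1" using z by simp
  then have "n mod d = 0" using least[of "n mod d"] d by (cases "n mod d = 0") auto
  then show "z \<in> (\<Union>d\<in>{d. d dvd n}. primitive_roots_unity d)"
    using d least by (auto simp: primitive_roots_unity_def mod_eq_0_iff_dvd)
next
  fix z :: complex
  assume "z \<in> (\<Union>d\<in>{d. d dvd n}. primitive_roots_unity d)"
  then show "z \<in> {z. z ^ n = 1}"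
    by (auto simp: primitive_roots_unity_def power_mult dvd_def)
qed

lemma power_minus_1_eq_prod_primitive:
  assumes "n > 0"
  shows "(monom 1 n - 1 :: complex poly)
    = (\<Prod>d | d dvd n. \<Prod>z\<in>primitive_roots_unity d. [:- z, 1:])"
proof -
  have "\<forall>d\<in>{d. d dvd n}. finite (primitive_roots_unity d)"
    using assms by (auto intro!: finite_primitive_roots_unity dest: dvd_pos_nat)
  moreover have "\<forall>d\<in>{d. d dvd n}. \<forall>e\<in>{d. d dvd n}.
      d \<noteq> e \<longrightarrow> primitive_roots_unity d \<inter> primitive_roots_unity e = {}"
  proof (intro ballI impI)
    fix d e assume "d \<in> {d. d dvd n}" "e \<in> {d. d dvd n}" and ne: "d \<noteq> e"
    then have "d > 0" "e > 0" using assms by (auto dest: dvd_pos_nat)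
    then show "primitive_roots_unity d \<inter> primitive_roots_unity e = {}"
      using ne by (cases d e rule: linorder_cases) (auto simp: primitive_roots_unity_def)
  qed
  ultimately show ?thesis
    unfolding power_minus_1_eq_prod_roots_unity[OF assms] roots_unity_eq_Union_primitive[OF assms]
    using assms by (intro prod.UNION_disjoint) auto
qed

lemma cyclotomic_ex:
  assumes "n > 0"
  shows "\<exists>p. map_poly of_rat p = (\<Prod>z\<in>primitive_roots_unity n. [:- z, 1:])"
  using assms
proof (induction n rule: less_induct)
  case (less n)
  let ?C = "\<lambda>d. \<Prod>z\<in>primitive_roots_unity d. [:- z, 1:]"
  let ?h = "map_poly of_rat :: rat poly \<Rightarrow> complex poly"
  let ?D = "{d. d dvd n \<and> d \<noteq> n}"
  have "\<exists>p. ?h p = ?C d" if "d \<in> ?D" for d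
  proof (rule less.IH)
    show "d < n" using that less.prems by (auto dest: dvd_imp_le)
    show "d > 0" using that less.prems by (auto dest: dvd_pos_nat)
  qed
  then obtain P where P: "\<And>d. d \<in> ?D \<Longrightarrow> ?h (P d) = ?C d" by metis
  define R where "R = (\<Prod>d\<in>?D. P d)"
  have hR: "?h R = (\<Prod>d\<in>?D. ?C d)"
    unfolding R_def map_poly_of_rat_prod by (rule prod.cong) (use P in auto)
  have fin: "finite ?D" using less.prems by (auto intro: finite_subset[of _ "{d. d dvd n}"])
  have "{d. d dvd n} = insert n ?D" by auto
  then have split: "(monom 1 n - 1 :: complex poly) = ?C n * ?h R"
    using power_minus_1_eq_prod_primitive[OF less.prems] fin by (simp add: hR)
  have hX: "?h (monom 1 n - 1) = monom 1 n - 1"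
    by (rule poly_eqI) (simp add: coeff_map_poly of_rat_diff)
  have "?h R \<noteq> 0"
  proof
    assume "?h R = 0"
    then have "coeff (monom 1 n - 1 :: complex poly) n = 0" by (simp add: split)
    then show False using less.prems by simp
  qed
  have dg: "degree (?h p) = degree p" for p by (rule degree_map_poly) simp
  define Q where "Q = (monom 1 n - 1) div R"
  define r where "r = (monom 1 n - 1) mod R"
  have "R \<noteq> 0" using \<open>?h R \<noteq> 0\<close> by auto
  have "monom 1 n - 1 = R * Q + r" unfolding Q_def r_def by simp
  then have "?h (monom 1 n - 1) = ?h R * ?h Q + ?h r"
    by (simp only: map_poly_of_rat_add map_poly_of_rat_mult)
  then have eq: "?h r = ?h R * (?C n - ?h Q)"
    using split hX by (simp add: algebra_simps)
  have "?C n - ?h Q = 0"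
  proof (rule ccontr)
    assume ne: "?C n - ?h Q \<noteq> 0"
    then have "?h r \<noteq> 0" using eq \<open>?h R \<noteq> 0\<close> by simp
    then have "r \<noteq> 0" by auto
    then have "degree r < degree R"
      unfolding r_def using \<open>R \<noteq> 0\<close> degree_mod_less' by blast
    moreover have "degree (?h r) \<ge> degree (?h R)"
      using eq ne \<open>?h R \<noteq> 0\<close> by (simp add: degree_mult_eq)
    ultimately show False by (simp add: dg)
  qed
  then have "?h Q = ?C n" by simp
  then show ?case by blast
qed

lemma of_rat_cyclotomic:
  assumes "n > 0"
  shows "map_poly of_rat (cyclotomic n) = (\<Prod>z\<in>primitive_roots_unity n. [:- z, 1:])"
  unfolding cyclotomic_def
proof (rule theI')
  show "\<exists>!p. map_poly of_rat p = (\<Prod>z\<in>primitive_roots_unity n. [:- z, 1:])"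
    using cyclotomic_ex[OF assms] map_poly_of_rat_inj by metis
qed


section \<open>Congruences of rational functions\<close>

text \<open>
  Rational functions in the indeterminate \<open>q\<close> are elements of the fraction field of the rational
  polynomials. The condition \<open>V \<noteq> 0\<close> follows from coprimality unless \<open>P\<close> is a unit, and is needed
  for \<open>U / V\<close> to be a genuine fraction.
\<close>
definition ratfun_cong :: "rat poly fract \<Rightarrow> rat poly fract \<Rightarrow> rat poly \<Rightarrow> bool"
  where "ratfun_cong A B P \<longleftrightarrow>
    (\<exists>U V. V \<noteq> 0 \<and> coprime V P \<and> A - B = to_fract P * (to_fract U / to_fract V))"

abbreviation polyq :: "rat poly"
  where "polyq \<equiv> [:0, 1:]"

abbreviation ratq :: "rat poly fract"
  where "ratq \<equiv> to_fract polyq"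

definition c_q :: "nat \<Rightarrow> rat poly fract"
  where "c_q k = (- 1) ^ k * qint ratq (4 * k + 1)
    * ((qpoch ratq (ratq ^ 2) k) ^ 4 * qpoch (ratq ^ 2) (ratq ^ 4) k)
    / ((qpoch (ratq ^ 2) (ratq ^ 2) k) ^ 4 * qpoch (ratq ^ 4) (ratq ^ 4) k)
    * ratq ^ k"

end

theory Submission
  imports Defs "HOL-Computational_Algebra.Field_as_Ring"
begin

text \<open>
  Write \<open>n = 2 N + 1\<close> and \<open>\<Phi>\<close> for the \<open>n\<close>-th cyclotomic polynomial. For \<open>N < k < n\<close> the term
  \<open>c(k)\<close> vanishes modulo \<open>\<Phi>^3\<close>, so modulo \<open>\<Phi>^3\<close> the double sum is the square of
  \<open>S = c(0) + \<dots> + c(N)\<close>. Modulo \<open>\<Phi>^2\<close>, one pair of factors \<open>(q;q^2)_k^2 / (q^2;q^2)_k^2\<close> of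
  \<open>c(k)\<close> may be replaced by \<open>(q^(1+n), q^(1-n); q^2)_k / (q^(2+n), q^(2-n); q^2)_k\<close>. The resulting
  sum is a terminating very-well-poised \<open>8\<phi>7\<close>, which Watson's transformation turns into a \<open>4\<phi>3\<close>
  evaluated by Andrews' q-analogue of Watson's \<open>3F2\<close> sum. This gives \<open>S\<close> modulo \<open>\<Phi>^2\<close>, and since
  that value is divisible by \<open>\<Phi>\<close>, also \<open>S^2\<close> modulo \<open>\<Phi>^3\<close>.

  For a proper divisor \<open>d > 1\<close> of \<open>n\<close> one has \<open>c(a d + r) \<equiv> C(a) c(r)\<close> modulo the \<open>d\<close>-th
  cyclotomic polynomial, where \<open>c(r) \<equiv> 0\<close> unless \<open>r \<le> (d - 1) / 2\<close>. Two such \<open>r\<close> add up to less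
  than \<open>d\<close>, so the double sum factors through the square of \<open>c(0) + \<dots> + c((d - 1) / 2) \<equiv> 0\<close>.
\<close>

section \<open>Terminating basic hypergeometric sums\<close>

lemma qpoch_0 [simp]: "qpoch x q 0 = 1"
  by (simp add: qpoch_def)

lemma qpoch_Suc: "qpoch x q (Suc m) = qpoch x q m * (1 - x * q ^ m)"
  by (simp add: qpoch_def)

lemma qpoch_shift: "qpoch x q m * (1 - x * q ^ m) = (1 - x) * qpoch (x * q) q m"
proof -
  have "qpoch x q (Suc m) = (1 - x) * qpoch (x * q) q m"
    unfolding qpoch_def by (subst prod.lessThan_Suc_shift) (simp add: mult_ac)
  then show ?thesis by (simp add: qpoch_Suc)
qed

lemma qpoch_eq_0_iff:
  "qpoch x q m = 0 \<longleftrightarrow> (\<exists>i<m. x * q ^ i = 1)" for x :: "'a::field"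
  unfolding qpoch_def by auto

text \<open>In q-series notation \<open>wpoly a q (q ^ k) j\<close> is \<open>(q^(-k), a q^k; q)_j\<close>.\<close>

definition wpoly :: "'a::field \<Rightarrow> 'a \<Rightarrow> 'a \<Rightarrow> nat \<Rightarrow> 'a"
  where "wpoly a q z j = qpoch (1 / z) q j * qpoch (a * z) q j"

lemma wpoly_0 [simp]: "wpoly a q z 0 = 1"
  by (simp add: wpoly_def)

lemma wpoly_Suc: "wpoly a q z (Suc j) = wpoly a q z j * ((1 - q ^ j / z) * (1 - a * z * q ^ j))"
  by (simp add: wpoly_def qpoch_Suc)

text \<open>Moving \<open>z\<close> to \<open>q * z\<close> adds one factor and drops one factor in
  each of the two factorials. The cross-multiplied form stays valid where such a factor
  vanishes.\<close>

lemma wpoly_shift: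
  assumes "q \<noteq> 0" "z \<noteq> 0"
  shows "wpoly a q (q * z) j * ((1 - q ^ j / (q * z)) * (1 - a * z))
    = wpoly a q z j * ((1 - 1 / (q * z)) * (1 - a * z * q ^ j))"
proof -
  have "qpoch (1 / (q * z)) q j * (1 - 1 / (q * z) * q ^ j) = (1 - 1 / (q * z)) * qpoch (1 / z) q j"
    using qpoch_shift[of "1 / (q * z)" q j] assms by simp
  moreover have "(1 - a * z) * qpoch (a * (q * z)) q j = qpoch (a * z) q j * (1 - a * z * q ^ j)"
    using qpoch_shift[of "a * z" q j] by (simp add: mult_ac)
  ultimately show ?thesis
    unfolding wpoly_def by (simp add: mult_ac)
qed

text \<open>The factor of index \<open>k\<close> in \<open>(q^(-k); q)_j\<close> is zero. Hence the
  sums over \<open>j\<close> stop at \<open>k\<close>, and one upper bound \<open>m\<close> can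
  serve several values of \<open>k\<close>.\<close>

lemma wpoly_eq_0: "k < j \<Longrightarrow> q \<noteq> 0 \<Longrightarrow> wpoly a q (q ^ k) j = 0"
  by (auto simp: wpoly_def qpoch_eq_0_iff intro!: exI[of _ k])

text \<open>
  The next three identities, with \<open>z = q ^ k\<close> and \<open>y = q ^ j\<close>, are the polynomial cores of
  telescoping (Gosper--Zeilberger) certificates.
\<close>

lemma pfaff_saalschuetz_certificate:
  fixes a b c q z y :: "'a::field"
  assumes "q \<noteq> 0" "z \<noteq> 0" "b \<noteq> 0" "c \<noteq> 0"
  shows "y * ((1 - a * q * z / b) * (1 - a * q * z / c) * ((1 - 1 / (q * z)) * (1 - a * y * z))
     - a * q / (b * c) * (1 - b * z) * (1 - c * z) * ((1 - y / (q * z)) * (1 - a * z)))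
   = (1 - a * q * z^2) * ((1 - a * q * y / (b * c)) * ((1 - y / (q * z)) * (1 - a * z * y))
      - (1 - y) * (1 - a * y / b) * (1 - a * y / c))"
  using assms
  by (simp add: field_simps power2_eq_square)

lemma six_phi_five_certificate:
  fixes a d e f z y :: "'a::field"
  assumes "a \<noteq> 0" "z \<noteq> 0"
  shows "(1 / z - a * z) * ((1 - y / z) * (1 - a * z * y) * (1 - d * e * f * y / a)
       - (1 - d * y) * (1 - e * y) * (1 - f * y))
   = - y * ((1 - d * z) * (1 - e * z) * (1 - f * z) * (1 - a * z * y) / z^2
      - (1 - d / (a * z)) * (1 - e / (a * z)) * (1 - f / (a * z)) * (1 - y / z) * (a * z)^2)"
  using assms
  by (simp add: field_simps power2_eq_square)

lemma andrews_certificate: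
  fixes a c q z y :: "'a::field"
  assumes "q \<noteq> 0" "z \<noteq> 0"
  shows "y * ((1 - a * z) * (1 - c * z) * ((1 - 1 / (q * z)) * (1 - 1 / z) * (1 - a * y * z / q) * (1 - a * y * z))
     - (1 - z) * (c - a * z) * ((1 - y / (q * z)) * (1 - y / z) * (1 - a * z / q) * (1 - a * z)))
   = - ((1 - a * z) * (1 - z) * (1 - a * z^2) / z) *
     ((1 - c * y^2) * ((1 - y / (q * z)) * (1 - a * y * z / q)) - (1 - y) * (1 - a * y^2 / q) * (1 - c * y / q))"
  using assms
  by (simp add: field_simps power2_eq_square)

section \<open>Closed forms obtained from telescoping recurrences\<close>

lemma eq_divide_mult:
  fixes X s W t :: "'a::field"
  assumes "X \<noteq> 0" "X * s = W * t"
  shows "s = W / X * t"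
  using assms by (simp add: nonzero_eq_divide_eq mult.commute)

lemma sum_telescope_eq:
  fixes F G :: "nat \<Rightarrow> 'a::ab_group_add"
  assumes "\<And>j. F j = G (Suc j) - G j"
  shows "(\<Sum>j\<le>m. F j) = G (Suc m) - G 0"
  by (induction m) (simp_all add: assms)

text \<open>The terminating balanced \<open>3phi2\<close> sum. Creative telescoping in
  \<open>j\<close> gives the first-order recurrence \<open>X s(k + 1) = W s(k)\<close> for the sum
  \<open>s(k)\<close>, and the right side solves it. The parameters are chosen so that the formula
  can be read from right to left, as an expansion of a well-poised quotient in the functions
  \<open>wpoly a q (q ^ k) j\<close>.\<close>

lemma q_pfaff_saalschuetz:
  fixes a b c q :: "'a::field"
  assumes nz: "q \<noteq> 0" "b \<noteq> 0" "c \<noteq> 0"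
    and q: "\<And>i. q ^ Suc i \<noteq> 1" and a: "\<And>i. a * q ^ i \<noteq> 1"
    and ab: "\<And>i. a * q / b * q ^ i \<noteq> 1" and ac: "\<And>i. a * q / c * q ^ i \<noteq> 1"
    and "k \<le> m"
  shows "(\<Sum>j\<le>m. wpoly a q (q ^ k) j * (qpoch (a * q / (b * c)) q j * q ^ j
            / (qpoch q q j * qpoch (a * q / b) q j * qpoch (a * q / c) q j)))
     = qpoch b q k * qpoch c q k / (qpoch (a * q / b) q k * qpoch (a * q / c) q k)
         * (a * q / (b * c)) ^ k"
  using \<open>k \<le> m\<close>
proof (induction k)
  case 0
  have "(\<Sum>j\<le>m. wpoly a q (q ^ 0) j * (qpoch (a * q / (b * c)) q j * q ^ j
            / (qpoch q q j * qpoch (a * q / b) q j * qpoch (a * q / c) q j)))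
     = (\<Sum>j\<in>{0}. wpoly a q (q ^ 0) j * (qpoch (a * q / (b * c)) q j * q ^ j
            / (qpoch q q j * qpoch (a * q / b) q j * qpoch (a * q / c) q j)))"
    using nz by (intro sum.mono_neutral_right) (auto simp del: power_0 intro!: wpoly_eq_0)
  then show ?case by simp
next
  case (Suc k)
  define z where "z = q ^ k"
  define V where "V j = qpoch (a * q / (b * c)) q j * q ^ j
      / (qpoch q q j * qpoch (a * q / b) q j * qpoch (a * q / c) q j)" for j
  \<comment> \<open>\<open>E j\<close> is the part \<open>(1/z, a q z; q)_(j-1)\<close> common to
    \<open>wpoly a q (q * z) j\<close> and \<open>wpoly a q z j\<close>, written as a quotient so
    that \<open>j = 0\<close> is covered.\<close>
  define E where "E j = wpoly a q (q * z) j / ((1 - 1 / (q * z)) * (1 - a * q ^ j * z))" for j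
  \<comment> \<open>The telescoping partner is read off the right side of
    \<open>pfaff_saalschuetz_certificate\<close>. Its factor \<open>1 - q ^ j\<close> vanishes at
    \<open>j = 0\<close>, and \<open>E\<close> vanishes at \<open>Suc m\<close>.\<close>
  define G where "G j = (1 - a * q * z^2) * V j * ((1 - q ^ j) * (1 - a * q ^ j / b)
      * (1 - a * q ^ j / c)) / q ^ j * E j" for j
  define X where "X = (1 - a * q * z / b) * (1 - a * q * z / c)"
  define W where "W = a * q / (b * c) * (1 - b * z) * (1 - c * z)"
  have z: "z \<noteq> 0" and y: "q ^ j \<noteq> 0" for j using nz by (simp_all add: z_def)
  have n1: "1 - 1 / (q * z) \<noteq> 0" using q[of k] z nz by (simp add: z_def)
  have n2: "1 - a * q ^ j * z \<noteq> 0" for j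
    using a[of "j + k"] by (simp add: z_def power_add mult_ac)
  have n3: "1 - a * z \<noteq> 0" using n2[of 0] by simp
  have P1: "wpoly a q (q * z) j = E j * ((1 - 1 / (q * z)) * (1 - a * q ^ j * z))" for j
    using n1 n2 by (simp add: E_def)
  have P2: "wpoly a q z j = E j * ((1 - q ^ j / (q * z)) * (1 - a * z))" for j
  proof -
    have "wpoly a q z j * ((1 - 1 / (q * z)) * (1 - a * q ^ j * z))
        = E j * ((1 - q ^ j / (q * z)) * (1 - a * z)) * ((1 - 1 / (q * z)) * (1 - a * q ^ j * z))"
      using wpoly_shift[OF \<open>q \<noteq> 0\<close> z, of a j] unfolding P1 by (simp only: mult_ac)
    then show ?thesis using n1 n2[of j] by (metis mult_right_cancel no_zero_divisors)
  qed
  have ES: "E (Suc j) = E j * ((1 - q ^ j / (q * z)) * (1 - a * z * q ^ j))" for j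
  proof -
    have "E (Suc j) * ((1 - 1 / (q * z)) * (1 - a * q ^ Suc j * z))
      = E j * ((1 - q ^ j / (q * z)) * (1 - a * z * q ^ j))
         * ((1 - 1 / (q * z)) * (1 - a * q ^ Suc j * z))"
      unfolding P1[of "Suc j", symmetric] wpoly_Suc P1[of j] by (simp add: mult_ac)
    then show ?thesis using n1 n2[of "Suc j"] by (metis mult_right_cancel no_zero_divisors)
  qed
  have VS: "V (Suc j) * ((1 - q * q ^ j) * (1 - a * (q * q ^ j) / b) * (1 - a * (q * q ^ j) / c))
     = V j * (q * (1 - a * q * q ^ j / (b * c)))" for j
  proof -
    have *: "1 - q * q ^ j \<noteq> 0" "1 - a * q * q ^ j / b \<noteq> 0" "1 - a * q * q ^ j / c \<noteq> 0"
      using q[of j] ab[of j] ac[of j] by simp_all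
    have e: "1 - a * (q * q ^ j) / b = 1 - a * q * q ^ j / b"
      "1 - a * (q * q ^ j) / c = 1 - a * q * q ^ j / c" by (simp_all add: mult_ac)
    define u v w where u: "u = 1 - q * q ^ j" "v = 1 - a * q * q ^ j / b" "w = 1 - a * q * q ^ j / c"
    have "V (Suc j) = V j * (q * (1 - a * q * q ^ j / (b * c))) / (u * v * w)"
      unfolding u V_def by (simp add: qpoch_Suc mult_ac)
    then show ?thesis unfolding e u[symmetric] using *[folded u] by simp
  qed
  have step: "X * (V j * wpoly a q (q * z) j) - W * (V j * wpoly a q z j) = G (Suc j) - G j" for j
  proof -
    define y where "y = q ^ j"
    have y0: "y \<noteq> 0" using y by (simp add: y_def)
    have GS: "G (Suc j) = (1 - a * q * z^2) * (V j * (1 - a * q * y / (b * c))) / y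
       * (E j * ((1 - y / (q * z)) * (1 - a * z * y)))"
    proof -
      have "G (Suc j) = (1 - a * q * z^2) * (V (Suc j) * ((1 - q * y) * (1 - a * (q * y) / b)
          * (1 - a * (q * y) / c))) / (q * y) * (E j * ((1 - y / (q * z)) * (1 - a * z * y)))"
        unfolding G_def ES by (simp only: y_def power_Suc mult_ac)
      then show ?thesis unfolding VS[of j, folded y_def] using nz by simp
    qed
    have "y * (X * (V j * wpoly a q (q * z) j) - W * (V j * wpoly a q z j))
       = V j * E j * (y * (X * ((1 - 1 / (q * z)) * (1 - a * y * z)) - W * ((1 - y / (q * z)) * (1 - a * z))))"
      by (simp add: P1 P2 y_def algebra_simps)
    also have "\<dots> = V j * E j * ((1 - a * q * z^2) * ((1 - a * q * y / (b * c)) * ((1 - y / (q * z)) * (1 - a * z * y))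
      - (1 - y) * (1 - a * y / b) * (1 - a * y / c)))"
      unfolding X_def W_def by (subst pfaff_saalschuetz_certificate[OF \<open>q \<noteq> 0\<close> z nz(2,3)]) simp
    also have "\<dots> = y * (G (Suc j) - G j)"
    proof -
      have "y * G (Suc j) = V j * E j * ((1 - a * q * z^2) * ((1 - a * q * y / (b * c)) * ((1 - y / (q * z)) * (1 - a * z * y))))"
        unfolding GS using y0 by simp
      moreover have "y * G j = V j * E j * ((1 - a * q * z^2) * ((1 - y) * (1 - a * y / b) * (1 - a * y / c)))"
        unfolding G_def y_def[symmetric] using y0 by simp
      ultimately show ?thesis by (simp only: right_diff_distrib)
    qed
    finally show ?thesis using y0 by simp
  qed
  have G0: "G 0 = 0" by (simp add: G_def)
  have "wpoly a q (q * z) (Suc m) = 0"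
    using wpoly_eq_0[of "Suc k" "Suc m" q a] Suc.prems nz by (simp add: z_def)
  then have Gm: "G (Suc m) = 0" by (simp add: G_def E_def)
  have "(\<Sum>j\<le>m. X * (V j * wpoly a q (q * z) j) - W * (V j * wpoly a q z j)) = 0"
    using sum_telescope_eq[of "\<lambda>j. X * (V j * wpoly a q (q * z) j) - W * (V j * wpoly a q z j)", OF step]
    by (simp add: G0 Gm)
  then have rec: "X * (\<Sum>j\<le>m. wpoly a q (q * z) j * V j) = W * (\<Sum>j\<le>m. wpoly a q z j * V j)"
    by (simp add: sum_subtractf sum_distrib_left mult_ac)
  have X: "X \<noteq> 0" using ab[of k] ac[of k] by (simp add: X_def z_def mult_ac)
  have IH: "(\<Sum>j\<le>m. wpoly a q z j * V j)
     = qpoch b q k * qpoch c q k / (qpoch (a * q / b) q k * qpoch (a * q / c) q k)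
         * (a * q / (b * c)) ^ k"
    using Suc by (simp add: V_def z_def)
  have "(\<Sum>j\<le>m. wpoly a q (q * z) j * V j) = W / X * (qpoch b q k * qpoch c q k
       / (qpoch (a * q / b) q k * qpoch (a * q / c) q k) * (a * q / (b * c)) ^ k)"
    using rec X unfolding IH by (intro eq_divide_mult)
  also have "\<dots> = qpoch b q (Suc k) * qpoch c q (Suc k)
       / (qpoch (a * q / b) q (Suc k) * qpoch (a * q / c) q (Suc k)) * (a * q / (b * c)) ^ Suc k"
    by (simp add: qpoch_Suc X_def W_def z_def mult_ac)
  finally show ?case by (simp add: V_def z_def)
qed

text \<open>The recurrence links indices of equal parity. With \<open>z = q ^ Suc k\<close> the sums
  for \<open>k + 2\<close> and \<open>k\<close> sit at \<open>q * z\<close> and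
  \<open>z / q\<close>, and two applications of \<open>wpoly_shift\<close> compare them.\<close>

lemma andrews_step:
  fixes a c q :: "'a::field"
  assumes nz: "q \<noteq> 0"
    and q: "\<And>i. q ^ Suc i \<noteq> 1" and a: "\<And>i. a * q ^ i \<noteq> 1" and c: "\<And>i. c * q ^ i \<noteq> 1"
    and "k + 2 \<le> m"
  defines "g \<equiv> \<lambda>k. \<Sum>j\<le>m. wpoly a q (q ^ k) j * (qpoch c (q ^ 2) j * q ^ j
       / (qpoch q q j * qpoch (a * q) (q ^ 2) j * qpoch c q j))"
  shows "(1 - a * q ^ Suc k) * (1 - c * q ^ Suc k) * g (k + 2) = (1 - q ^ Suc k) * (c - a * q ^ Suc k) * g k"
proof -
  define z where "z = q ^ Suc k"
  define V where "V j = qpoch c (q ^ 2) j * q ^ j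
       / (qpoch q q j * qpoch (a * q) (q ^ 2) j * qpoch c q j)" for j
  \<comment> \<open>The part \<open>(q/z, a q z; q)_(j-2)\<close> common to \<open>wpoly\<close> at
    \<open>q * z\<close> and at \<open>z / q\<close>, continued to small \<open>j\<close> by
    division.\<close>
  define E where "E j = wpoly a q (q * z) j
      / ((1 - 1 / (q * z)) * (1 - 1 / z) * (1 - a * q ^ j * z / q) * (1 - a * q ^ j * z))" for j
  define K where "K = - ((1 - a * z) * (1 - z) * (1 - a * z^2) / z)"
  define G where "G j = K * V j * ((1 - q ^ j) * (1 - a * (q ^ j)^2 / q)
      * (1 - c * q ^ j / q)) / q ^ j * E j" for j
  define X where "X = (1 - a * z) * (1 - c * z)"
  define W where "W = (1 - z) * (c - a * z)"
  have z: "z \<noteq> 0" and y: "q ^ j \<noteq> 0" for j using nz by (simp_all add: z_def)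
  have zq: "z / q = q ^ k" using nz by (simp add: z_def)
  have n1: "1 - 1 / (q * z) \<noteq> 0" using q[of "Suc k"] z nz by (simp add: z_def)
  have n1': "1 - 1 / z \<noteq> 0" using q[of k] z nz by (simp add: z_def)
  have n2: "1 - a * q ^ j * z \<noteq> 0" for j
    using a[of "j + Suc k"] by (simp add: z_def power_add mult_ac)
  have n2': "1 - a * q ^ j * z / q \<noteq> 0" for j
    using a[of "j + k"] nz by (simp add: z_def power_add mult_ac)
  have P1: "wpoly a q (q * z) j = E j
      * ((1 - 1 / (q * z)) * (1 - 1 / z) * (1 - a * q ^ j * z / q) * (1 - a * q ^ j * z))" for j
    using n1 n1' n2[of j] n2'[of j] by (simp add: E_def)
  have P2: "wpoly a q (z / q) j = E j
      * ((1 - q ^ j / (q * z)) * (1 - q ^ j / z) * (1 - a * z / q) * (1 - a * z))" for j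
  proof -
    let ?D = "(1 - 1 / (q * z)) * (1 - 1 / z) * (1 - a * q ^ j * z / q) * (1 - a * q ^ j * z)"
    have 1: "wpoly a q (q * z) j * ((1 - q ^ j / (q * z)) * (1 - a * z))
       = wpoly a q z j * ((1 - 1 / (q * z)) * (1 - a * z * q ^ j))"
      using nz z by (rule wpoly_shift)
    have 2: "wpoly a q z j * ((1 - q ^ j / z) * (1 - a * z / q))
       = wpoly a q (z / q) j * ((1 - 1 / z) * (1 - a * z / q * q ^ j))"
      using wpoly_shift[OF nz, of "z / q" a j] nz z by simp
    have "wpoly a q (z / q) j * ?D
        = wpoly a q (z / q) j * ((1 - 1 / z) * (1 - a * z / q * q ^ j)) * ((1 - 1 / (q * z)) * (1 - a * z * q ^ j))"
      by (simp add: mult_ac)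
    also have "\<dots> = wpoly a q z j * ((1 - 1 / (q * z)) * (1 - a * z * q ^ j)) * ((1 - q ^ j / z) * (1 - a * z / q))"
      unfolding 2[symmetric] by (simp only: mult_ac)
    also have "\<dots> = E j * ((1 - q ^ j / (q * z)) * (1 - q ^ j / z) * (1 - a * z / q) * (1 - a * z)) * ?D"
      unfolding 1[symmetric] P1 by (simp only: mult_ac)
    finally show ?thesis using n1 n1' n2[of j] n2'[of j]
      by (metis mult_right_cancel no_zero_divisors)
  qed
  have ES: "E (Suc j) = E j * ((1 - q ^ j / (q * z)) * (1 - a * q ^ j * z / q))" for j
  proof -
    let ?D = "(1 - 1 / (q * z)) * (1 - 1 / z) * (1 - a * q ^ Suc j * z / q) * (1 - a * q ^ Suc j * z)"
    have e: "1 - a * q ^ Suc j * z / q = 1 - a * q ^ j * z" using nz by simp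
    have "E (Suc j) * ?D = wpoly a q (q * z) (Suc j)" by (simp only: P1)
    also have "\<dots> = E j * ((1 - q ^ j / (q * z)) * (1 - a * q ^ j * z / q)) * ?D"
      unfolding wpoly_Suc P1[of j] e by (simp only: mult_ac power_Suc)
    finally have "E (Suc j) * ?D = E j * ((1 - q ^ j / (q * z)) * (1 - a * q ^ j * z / q)) * ?D" .
    moreover have "?D \<noteq> 0" using n1 n1' n2[of "Suc j"] n2'[of "Suc j"] by (metis no_zero_divisors)
    ultimately show ?thesis by (metis mult_right_cancel)
  qed
  have VS: "V (Suc j) * ((1 - q * q ^ j) * (1 - a * (q * q ^ j)^2 / q) * (1 - c * (q * q ^ j) / q))
     = V j * (q * (1 - c * (q ^ j)^2))" for j
  proof -
    have *: "1 - q * q ^ j \<noteq> 0" "1 - a * q * (q ^ 2) ^ j \<noteq> 0" "1 - c * q ^ j \<noteq> 0"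
      using q[of j] a[of "Suc (2 * j)"] c[of j] by (simp_all add: power_mult[symmetric] mult_ac)
    have e: "1 - a * (q * q ^ j)^2 / q = 1 - a * q * (q ^ 2) ^ j"
      "1 - c * (q * q ^ j) / q = 1 - c * q ^ j" "(q ^ j)^2 = (q^2)^j" using nz
      by (simp_all add: power2_eq_square power_mult_distrib mult_ac)
    show ?thesis unfolding e using *
      by (simp add: V_def qpoch_Suc mult_ac)
  qed
  have step: "X * (V j * wpoly a q (q * z) j) - W * (V j * wpoly a q (z / q) j) = G (Suc j) - G j" for j
  proof -
    define y where "y = q ^ j"
    have y0: "y \<noteq> 0" using y by (simp add: y_def)
    have GS: "G (Suc j) = K * (V j * (1 - c * y^2)) / y
       * (E j * ((1 - y / (q * z)) * (1 - a * y * z / q)))"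
    proof -
      have "G (Suc j) = K * (V (Suc j) * ((1 - q * y) * (1 - a * (q * y)^2 / q)
          * (1 - c * (q * y) / q))) / (q * y) * (E j * ((1 - y / (q * z)) * (1 - a * y * z / q)))"
        unfolding G_def ES by (simp only: y_def power_Suc mult_ac)
      then show ?thesis unfolding VS[of j, folded y_def] using nz by simp
    qed
    have "y * (X * (V j * wpoly a q (q * z) j) - W * (V j * wpoly a q (z / q) j))
       = V j * E j * (y * (X * ((1 - 1 / (q * z)) * (1 - 1 / z) * (1 - a * y * z / q) * (1 - a * y * z))
           - W * ((1 - y / (q * z)) * (1 - y / z) * (1 - a * z / q) * (1 - a * z))))"
      unfolding P1 P2 y_def by (simp only: right_diff_distrib mult_ac)
    also have "\<dots> = V j * E j * (K *
        ((1 - c * y^2) * ((1 - y / (q * z)) * (1 - a * y * z / q)) - (1 - y) * (1 - a * y^2 / q) * (1 - c * y / q)))"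
      unfolding X_def W_def K_def by (subst andrews_certificate[OF nz z]) simp
    also have "\<dots> = y * (G (Suc j) - G j)"
    proof -
      have "y * G (Suc j) = V j * E j * (K * ((1 - c * y^2) * ((1 - y / (q * z)) * (1 - a * y * z / q))))"
        unfolding GS using y0 by simp
      moreover have "y * G j = V j * E j * (K * ((1 - y) * (1 - a * y^2 / q) * (1 - c * y / q)))"
        unfolding G_def y_def[symmetric] using y0 by simp
      ultimately show ?thesis by (simp only: right_diff_distrib)
    qed
    finally show ?thesis using y0 by simp
  qed
  have G0: "G 0 = 0" by (simp add: G_def)
  have "wpoly a q (q * z) (Suc m) = 0"
    using wpoly_eq_0[of "k + 2" "Suc m" q a] \<open>k + 2 \<le> m\<close> nz by (simp add: z_def)
  then have Gm: "G (Suc m) = 0" by (simp add: G_def E_def)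
  have "(\<Sum>j\<le>m. X * (V j * wpoly a q (q * z) j) - W * (V j * wpoly a q (z / q) j)) = 0"
    using sum_telescope_eq[of "\<lambda>j. X * (V j * wpoly a q (q * z) j) - W * (V j * wpoly a q (z / q) j)", OF step]
    by (simp add: G0 Gm)
  then have "X * (\<Sum>j\<le>m. wpoly a q (q * z) j * V j) = W * (\<Sum>j\<le>m. wpoly a q (z / q) j * V j)"
    by (simp add: sum_subtractf sum_distrib_left mult_ac)
  then show ?thesis
    unfolding zq by (simp add: X_def W_def g_def V_def z_def mult_ac)
qed

text \<open>Andrews' terminating \<open>4phi3\<close>. The factorial \<open>(c; q^2)_j\<close>
  stands for the pair in base \<open>q\<close> at the two square roots of \<open>c\<close>, and
  \<open>(a q; q^2)_j\<close> likewise, so that no square roots occur. The recurrence of step two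
  separates the parities; the odd values vanish because the value at \<open>1\<close> does.\<close>

lemma andrews_sum:
  fixes a c q :: "'a::field"
  assumes nz: "q \<noteq> 0" "c \<noteq> 0"
    and q: "\<And>i. q ^ Suc i \<noteq> 1" and a: "\<And>i. a * q ^ i \<noteq> 1" and c: "\<And>i. c * q ^ i \<noteq> 1"
    and "k \<le> m"
  shows "(\<Sum>j\<le>m. wpoly a q (q ^ k) j * (qpoch c (q ^ 2) j * q ^ j
       / (qpoch q q j * qpoch (a * q) (q ^ 2) j * qpoch c q j)))
     = (if odd k then 0 else c ^ (k div 2) * (qpoch q (q ^ 2) (k div 2) * qpoch (a * q / c) (q ^ 2) (k div 2))
         / (qpoch (a * q) (q ^ 2) (k div 2) * qpoch (c * q) (q ^ 2) (k div 2)))"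
  (is "?g k = ?r k")
  using \<open>k \<le> m\<close>
proof (induction k rule: less_induct)
  case (less k)
  consider "k = 0" | "k = 1" | l where "k = l + 2"
    by (metis add_2_eq_Suc' not0_implies_Suc One_nat_def)
  then show ?case
  proof cases
    case 1
    have "?g 0 = (\<Sum>j\<in>{0}. wpoly a q (q ^ 0) j * (qpoch c (q ^ 2) j * q ^ j
       / (qpoch q q j * qpoch (a * q) (q ^ 2) j * qpoch c q j)))"
      using nz by (intro sum.mono_neutral_right) (auto simp del: power_0 intro!: wpoly_eq_0)
    then show ?thesis using 1 by simp
  next
    case 2
    \<comment> \<open>Two terms survive at \<open>k = 1\<close>, and they cancel.\<close>
    have "?g 1 = (\<Sum>j\<in>{0, 1}. wpoly a q (q ^ 1) j * (qpoch c (q ^ 2) j * q ^ j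
       / (qpoch q q j * qpoch (a * q) (q ^ 2) j * qpoch c q j)))"
      using nz less.prems 2 wpoly_eq_0[of 1 _ q a] by (intro sum.mono_neutral_right) auto
    also have "\<dots> = 0"
    proof -
      have "1 - c \<noteq> 0" "1 - q \<noteq> 0" "1 - a * q \<noteq> 0" using q[of 0] c[of 0] a[of 1] by simp_all
      then have "c \<noteq> 1" "q \<noteq> 1" "a * q \<noteq> 1" "1 + (1 - 1 / q) * q / (1 - q) = 0"
        using nz by (auto simp: field_simps)
      then show ?thesis by (simp add: wpoly_def qpoch_def)
    qed
    finally show ?thesis using 2 by simp
  next
    case 3
    define z where "z = q ^ Suc l"
    define X where "X = (1 - a * z) * (1 - c * z)"
    define W where "W = (1 - z) * (c - a * z)"
    have IH: "?g l = ?r l" using less.IH[of l] less.prems 3 by simp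
    have rec: "X * ?g (l + 2) = W * ?g l"
      using andrews_step[OF nz(1) q a c, of l m] less.prems 3 by (simp add: X_def W_def z_def)
    have X: "X \<noteq> 0" using a[of "Suc l"] c[of "Suc l"] by (simp add: X_def z_def)
    have "?g (l + 2) = W / X * ?r l" using rec X unfolding IH by (intro eq_divide_mult)
    also have "\<dots> = ?r (l + 2)"
    proof (cases "odd l")
      case False
      obtain m where m: "l = 2 * m" using False by (auto elim: evenE)
      have zz: "z = q * (q ^ 2) ^ m" by (simp add: z_def m power_mult)
      have W: "W = (1 - q * (q ^ 2) ^ m) * (c * (1 - a * q / c * (q ^ 2) ^ m))"
        unfolding W_def zz using nz by (simp add: field_simps)
      have X: "X = (1 - a * q * (q ^ 2) ^ m) * (1 - c * q * (q ^ 2) ^ m)"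
        unfolding X_def zz by (simp add: mult_ac)
      show ?thesis unfolding W X by (simp add: m qpoch_Suc mult_ac)
    qed simp
    finally show ?thesis using 3 by simp
  qed
qed

text \<open>
  The inner sum in Bailey's proof of Watson's transformation, as a recurrence in \<open>j\<close>; the
  telescoping is in \<open>k\<close>.
\<close>

lemma six_phi_five_step:
  fixes a d e f q :: "'a::field"
  assumes nz: "q \<noteq> 0" "a \<noteq> 0" "d \<noteq> 0" "e \<noteq> 0" "f \<noteq> 0"
    and q: "\<And>i. q ^ Suc i \<noteq> 1" and a: "\<And>i. a * q ^ i \<noteq> 1"
    and ad: "\<And>i. a * q / d * q ^ i \<noteq> 1" and ae: "\<And>i. a * q / e * q ^ i \<noteq> 1"
    and af: "\<And>i. i < N \<Longrightarrow> a * q / f * q ^ i \<noteq> 1" and f: "f * q ^ N = 1"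
  defines "w \<equiv> \<lambda>k. (1 - a * (q ^ k)^2) * (qpoch a q k * qpoch d q k * qpoch e q k * qpoch f q k)
      / (qpoch q q k * qpoch (a * q / d) q k * qpoch (a * q / e) q k * qpoch (a * q / f) q k)
      * (a * q / (d * e * f)) ^ k"
  shows "(1 - d * e * f / a * q ^ j) * (\<Sum>k\<le>N. w k * wpoly a q (q ^ k) (Suc j))
     = (1 - d * q ^ j) * (1 - e * q ^ j) * (1 - f * q ^ j) * (\<Sum>k\<le>N. w k * wpoly a q (q ^ k) j)"
proof -
  define y where "y = q ^ j"
  define r where "r = (1 - d * y) * (1 - e * y) * (1 - f * y)"
  define D where "D z = 1 / z - a * z" for z
  define A where "A z = (1 - d * z) * (1 - e * z) * (1 - f * z) * (1 - a * z * y) / z^2" for z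
  define B where "B z = (1 - d / (a * z)) * (1 - e / (a * z)) * (1 - f / (a * z)) * (1 - y / z) * (a * z)^2" for z
  \<comment> \<open>The cut-off fits the termination: \<open>f * q ^ N = 1\<close> makes
    \<open>A (q ^ N)\<close> zero, so \<open>HS\<close> holds at \<open>k = N\<close> too. Quotients
    beyond \<open>N\<close>, about which \<open>af\<close> says nothing, are avoided.\<close>
  define H where "H k = (if k \<le> N then - y * w k * wpoly a q (q ^ k) j * B (q ^ k) / D (q ^ k) else 0)" for k
  have D: "D (q ^ k) \<noteq> 0" for k
    using a[of "2 * k"] nz by (simp add: D_def field_simps power_mult power2_eq_square)
  \<comment> \<open>The ratio of \<open>w (Suc k)\<close> to \<open>w k\<close> turns the
    \<open>B\<close>-form at \<open>k + 1\<close> into an \<open>A\<close>-form at \<open>k\<close>,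
    as the certificate requires.\<close>
  have HS: "H (Suc k) = - y * w k * wpoly a q (q ^ k) j * A (q ^ k) / D (q ^ k)" if "k \<le> N" for k
  proof (cases "k = N")
    case True
    then show ?thesis using f by (simp add: H_def A_def)
  next
    case False
    with that have kN: "k < N" by simp
    define z where "z = q ^ k"
    define p where "p = wpoly a q z j"
    define w0 where "w0 = w k"
    define w1 where "w1 = w (Suc k)"
    define p1 where "p1 = wpoly a q (q * z) j"
    have z: "z \<noteq> 0" using nz by (simp add: z_def)
    have n: "1 - q * z \<noteq> 0" "1 - a * z \<noteq> 0" "1 - a * q * z / d \<noteq> 0" "1 - a * q * z / e \<noteq> 0"
        "1 - a * q * z / f \<noteq> 0" "1 - a * z^2 \<noteq> 0" "1 - a * (q * z)^2 \<noteq> 0"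
      using q[of k] a[of k] ad[of k] ae[of k] af[of k] kN a[of "2 * k"] a[of "2 * Suc k"]
      by (simp_all add: z_def power_mult power2_eq_square mult_ac power_mult_distrib)
    have W: "w1 = w0 * ((1 - a * (q * z)^2) / (1 - a * z^2) * ((1 - a * z) * (1 - d * z) * (1 - e * z) * (1 - f * z))
       / ((1 - q * z) * (1 - a * q * z / d) * (1 - a * q * z / e) * (1 - a * q * z / f)) * (a * q / (d * e * f)))"
      unfolding w1_def w0_def w_def using n(6)
      by (simp add: qpoch_Suc z_def mult_ac)
    have P: "p1 * (1 - y / (q * z)) = p * ((1 - 1 / (q * z)) * (1 - a * z * y) / (1 - a * z))"
      using wpoly_shift[OF nz(1) z, of a j] n(2) unfolding p_def p1_def y_def
      by (simp add: nonzero_eq_divide_eq mult_ac)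
    have Dz: "D z = (1 - a * z^2) / z" "D (q * z) = (1 - a * (q * z)^2) / (q * z)"
      using z nz by (simp_all add: D_def field_simps power2_eq_square)
    have e: "1 - d / (a * (q * z)) = - d / (a * q * z) * (1 - a * q * z / d)"
      "1 - e / (a * (q * z)) = - e / (a * q * z) * (1 - a * q * z / e)"
      "1 - f / (a * (q * z)) = - f / (a * q * z) * (1 - a * q * z / f)"
      "1 - 1 / (q * z) = - 1 / (q * z) * (1 - q * z)"
      using nz z by (simp_all add: field_simps)
    define u1 u2 u3 u4 u5 u6 u7 where u: "u1 = 1 - q * z" "u2 = 1 - a * z" "u3 = 1 - a * q * z / d"
      "u4 = 1 - a * q * z / e" "u5 = 1 - a * q * z / f" "u6 = 1 - a * z^2" "u7 = 1 - a * (q * z)^2"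
    have un: "u1 \<noteq> 0" "u2 \<noteq> 0" "u3 \<noteq> 0" "u4 \<noteq> 0" "u5 \<noteq> 0" "u6 \<noteq> 0" "u7 \<noteq> 0"
      using n by (simp_all add: u)
    have "H (Suc k) = - y * w1 * (p1 * (1 - y / (q * z))) * ((1 - d / (a * (q * z))) * (1 - e / (a * (q * z)))
        * (1 - f / (a * (q * z))) * (a * (q * z))^2) / D (q * z)"
      using kN by (simp add: H_def B_def w1_def p1_def z_def mult_ac)
    also have "\<dots> = - y * w0 * p * A z / D z"
      unfolding W P Dz e A_def u[symmetric] using un nz z
      by (simp add: field_simps power2_eq_square)
    finally show ?thesis by (simp add: w0_def p_def z_def)
  qed
  have step: "(1 - d * e * f / a * y) * (w k * wpoly a q (q ^ k) (Suc j)) - r * (w k * wpoly a q (q ^ k) j)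
       = H (Suc k) - H k" if "k \<le> N" for k
  proof -
    define z where "z = q ^ k"
    have z: "z \<noteq> 0" using nz by (simp add: z_def)
    have Dz: "D z \<noteq> 0" using D by (simp add: z_def)
    define p where "p = wpoly a q z j"
    have "D z * ((1 - y / z) * (1 - a * z * y) * (1 - d * e * f * y / a) - r) = - y * (A z - B z)"
      unfolding D_def r_def A_def B_def by (rule six_phi_five_certificate[OF nz(2) z])
    then have *: "(1 - y / z) * (1 - a * z * y) * (1 - d * e * f * y / a) - r = - y * (A z - B z) / D z"
      using Dz by (metis nonzero_mult_div_cancel_left)
    have "(1 - d * e * f / a * y) * (w k * wpoly a q z (Suc j)) - r * (w k * p)
      = w k * p * ((1 - y / z) * (1 - a * z * y) * (1 - d * e * f * y / a) - r)"
      unfolding right_diff_distrib[of "w k * p"] wpoly_Suc y_def[symmetric] p_def[symmetric]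
        times_divide_eq_left by (simp only: mult_ac)
    also have "\<dots> = w k * p * (- y * (A z - B z) / D z)" by (simp only: *)
    also have "\<dots> = H (Suc k) - H k"
    proof -
      have "H (Suc k) = w k * p * (- y * A z / D z)" "H k = w k * p * (- y * B z / D z)"
        using that unfolding HS[OF that] by (simp_all add: H_def p_def z_def)
      then show ?thesis by (simp only: right_diff_distrib diff_divide_distrib)
    qed
    finally show ?thesis by (simp add: p_def z_def)
  qed
  \<comment> \<open>At \<open>z = 1\<close> the factor \<open>1 - y / z\<close> of \<open>B\<close>
    is zero for \<open>j = 0\<close>; for \<open>j > 0\<close> already \<open>(1; q)_j\<close> is
    zero.\<close>
  have H0: "H 0 = 0"
  proof -
    have "wpoly a q 1 j * (1 - y) = 0"
      using wpoly_eq_0[of 0 "Suc j" q a] nz wpoly_eq_0[of 0 j q a]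
      by (cases j) (auto simp: y_def)
    then show ?thesis by (auto simp: H_def B_def)
  qed
  have "(\<Sum>k\<le>N. (1 - d * e * f / a * y) * (w k * wpoly a q (q ^ k) (Suc j)) - r * (w k * wpoly a q (q ^ k) j))
     = (\<Sum>k\<le>N. H (Suc k) - H k)"
    by (rule sum.cong) (use step in auto)
  also have "\<dots> = 0" by (subst sum_telescope_eq[where G = H]) (simp_all add: H0, simp add: H_def)
  finally show ?thesis
    by (simp add: sum_subtractf sum_distrib_left y_def r_def)
qed

section \<open>The exact evaluation behind the congruence\<close>

lemma qpoch_mult_minus:
  "qpoch x q k * qpoch (- x) q k = qpoch (x ^ 2) (q ^ 2) k" for x q :: "'a::field"
  unfolding qpoch_def prod.distrib[symmetric]
  by (rule prod.cong) (auto simp: algebra_simps power2_eq_square power_mult_distrib)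

text \<open>The factors are taken in reverse order, and
  \<open>1 - 1 / u = (1 - u) * (- 1 / u)\<close> is applied to each with
  \<open>u = x * q ^ i\<close>.\<close>

lemma qpoch_reverse:
  fixes x q :: "'a::field"
  assumes "q \<noteq> 0" "x \<noteq> 0"
  shows "qpoch (q / (x * q ^ N)) q N = qpoch x q N * (\<Prod>i<N. - 1 / (x * q ^ i))"
proof -
  have "qpoch (q / (x * q ^ N)) q N = (\<Prod>i<N. 1 - q / (x * q ^ N) * q ^ (N - Suc i))"
    unfolding qpoch_def by (rule prod.nat_diff_reindex[symmetric])
  also have "\<dots> = (\<Prod>i<N. (1 - x * q ^ i) * (- 1 / (x * q ^ i)))"
  proof (rule prod.cong)
    fix i assume "i \<in> {..<N}"
    then have "q ^ N = q ^ (N - Suc i) * (q * q ^ i)"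
      by (metis Suc_leI add.commute lessThan_iff le_add_diff_inverse power_Suc power_add)
    then show "1 - q / (x * q ^ N) * q ^ (N - Suc i) = (1 - x * q ^ i) * (- 1 / (x * q ^ i))"
      using assms by (simp add: field_simps)
  qed simp
  finally show ?thesis by (simp only: prod.distrib qpoch_def)
qed

lemma qint_eq: "qint q m * (1 - q) = 1 - q ^ m" for q :: "'a::comm_ring_1"
  by (simp add: qint_def one_diff_power_eq mult.commute)

text \<open>A \<open>q\<close>-analogue of \<open>binomial(2 k, k) / 4^k\<close>. Its values at
  \<open>q\<close> and at \<open>q ^ 2\<close> supply all the factorials in
  \<open>c_q\<close>.\<close>

definition poch_ratio :: "'a::field \<Rightarrow> nat \<Rightarrow> 'a"
  where "poch_ratio q k = qpoch q (q ^ 2) k / qpoch (q ^ 2) (q ^ 2) k"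

text \<open>The quotients \<open>q / q ^ n\<close> and \<open>q ^ 2 / q ^ n\<close> stand for \<open>q^(1-n)\<close> and \<open>q^(2-n)\<close>.\<close>

definition shifted_ratio :: "'a::field \<Rightarrow> nat \<Rightarrow> nat \<Rightarrow> 'a"
  where "shifted_ratio q n k = qpoch (q ^ (n + 1)) (q ^ 2) k * qpoch (q / q ^ n) (q ^ 2) k
     / (qpoch (q ^ (n + 2)) (q ^ 2) k * qpoch (q ^ 2 / q ^ n) (q ^ 2) k)"

text \<open>In base \<open>Q = q^2\<close> the left side is very-well-poised with
  \<open>a = q\<close> and the further parameters \<open>q, - q, q, e, f\<close>, where
  \<open>f = Q^(-N)\<close> forces termination. Following Bailey, the quotient belonging to the pair
  \<open>q, - q\<close> is expanded by \<open>q_pfaff_saalschuetz\<close> and the summations are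
  interchanged. The inner sums \<open>S j\<close> reduce to \<open>S 0\<close> by
  \<open>six_phi_five_step\<close>, and \<open>andrews_sum\<close> evaluates the outer sum.\<close>

lemma watson_andrews:
  fixes q :: "'a::field"
  assumes q0: "q \<noteq> 0" and q1: "\<And>i. q ^ Suc i \<noteq> 1" and n_def: "n = 2 * N + 1"
  shows "(\<Sum>k\<le>N. (- q) ^ k * qint q (4 * k + 1) * poch_ratio q k ^ 2 * shifted_ratio q n k * poch_ratio (q ^ 2) k)
    = (if odd N then 0 else qint q n * poch_ratio (q ^ 2) (N div 2) ^ 2)"
proof -
  have inj: "q ^ i \<noteq> q ^ j" if ij: "i < j" for i j
  proof
    assume "q ^ i = q ^ j"
    also have "q ^ j = q ^ i * q ^ Suc (j - i - 1)" using that by (simp flip: power_add power_Suc)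
    finally show False using q0 q1[of "j - i - 1"] by simp
  qed
  define Q where "Q = q ^ 2"
  define e where "e = Q * Q ^ N"
  define f where "f = 1 / Q ^ N"
  have nz: "Q \<noteq> 0" "e \<noteq> 0" "f \<noteq> 0" using q0 by (simp_all add: Q_def e_def f_def)
  have Qpow: "Q ^ i = q ^ (2 * i)" for i by (simp add: Q_def power_mult)
  have Q1: "Q ^ Suc i \<noteq> 1" for i using q1[of "2 * i + 1"] unfolding Qpow by simp
  have q1': "q ^ i \<noteq> 1" if "0 < i" for i using q1[of "i - 1"] that by simp
  have a1: "q * Q ^ i \<noteq> 1" for i using q1[of "2 * i"] by (simp add: Qpow)
  have ef: "e * f = Q" using nz by (simp add: e_def f_def)
  define w where "w k = (1 - q * (Q ^ k)^2) * (qpoch q Q k * qpoch q Q k * qpoch e Q k * qpoch f Q k)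
      / (qpoch Q Q k * qpoch (q * Q / q) Q k * qpoch (q * Q / e) Q k * qpoch (q * Q / f) Q k)
      * (q * Q / (q * e * f)) ^ k" for k
  define S where "S j = (\<Sum>k\<le>N. w k * wpoly q Q (Q ^ k) j)" for j
  \<comment> \<open>An odd power of \<open>q\<close> is compared with an even one.\<close>
  have ae: "q * Q / e * Q ^ i \<noteq> 1" for i
  proof -
    have "q ^ (2 * i + 3) \<noteq> q ^ (2 * N + 2)"
      using inj[of "2 * i + 3" "2 * N + 2"] inj[of "2 * N + 2" "2 * i + 3"]
      by (metis even_add even_mult_iff even_numeral linorder_neqE_nat odd_numeral)
    moreover have "q * Q * Q ^ i = q ^ (2 * i + 3)" "e = q ^ (2 * N + 2)"
      unfolding e_def Qpow unfolding Q_def by (simp_all add: power_add power2_eq_square power3_eq_cube mult_ac)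
    ultimately have "q * Q * Q ^ i \<noteq> e" by simp
    moreover have "q * Q / e * Q ^ i = q * Q * Q ^ i / e" by simp
    ultimately show ?thesis using divide_eq_1_iff[of "q * Q * Q ^ i" e] by metis
  qed
  have af: "q * Q / f * Q ^ i \<noteq> 1" for i
    using a1[of "Suc (N + i)"] by (simp add: f_def power_add mult_ac)
  have Sstep: "(1 - Q * Q ^ j) * S (Suc j) = (1 - q * Q ^ j) * (1 - e * Q ^ j) * (1 - f * Q ^ j) * S j" for j
  proof -
    have "(1 - q * e * f / q * Q ^ j) * S (Suc j) = (1 - q * Q ^ j) * (1 - e * Q ^ j) * (1 - f * Q ^ j) * S j"
      unfolding S_def w_def
    proof (rule six_phi_five_step)
      show "q * Q / q * Q ^ i \<noteq> 1" for i using Q1[of i] q0 by simp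
      show "f * Q ^ N = 1" using nz by (simp add: f_def)
    qed (use q0 nz Q1 a1 ae af in auto)
    moreover have "q * e * f / q = Q" using ef q0 by simp
    ultimately show ?thesis by simp
  qed
  have QQ: "qpoch Q Q j \<noteq> 0" for j using Q1 by (simp add: qpoch_eq_0_iff flip: power_Suc)
  have Sj: "S j * qpoch Q Q j = qpoch q Q j * qpoch e Q j * qpoch f Q j * S 0" for j
  proof (induction j)
    case (Suc j)
    have "S (Suc j) * qpoch Q Q (Suc j) = ((1 - Q * Q ^ j) * S (Suc j)) * qpoch Q Q j"
      by (simp add: qpoch_Suc mult_ac)
    also have "\<dots> = (1 - q * Q ^ j) * (1 - e * Q ^ j) * (1 - f * Q ^ j) * (S j * qpoch Q Q j)"
      unfolding Sstep by (simp only: mult_ac)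
    finally show ?case unfolding Suc by (simp add: qpoch_Suc mult_ac)
  qed simp
  have qQ: "qpoch q Q j \<noteq> 0" for j using a1 by (simp add: qpoch_eq_0_iff)
  have eQ: "qpoch e Q j \<noteq> 0" for j using Q1
    by (simp add: qpoch_eq_0_iff e_def mult.assoc flip: power_Suc power_add)
  have fQ: "qpoch f Q N \<noteq> 0"
  proof -
    have "Q ^ i \<noteq> Q ^ N" if "i < N" for i using inj[of "2 * i" "2 * N"] that by (simp add: Qpow)
    then show ?thesis using nz by (auto simp: qpoch_eq_0_iff f_def)
  qed
  \<comment> \<open>At \<open>j = N\<close> only the term \<open>k = N\<close> survives. This
    determines \<open>S 0\<close>, since the factorials that link \<open>S N\<close> and
    \<open>S 0\<close> in \<open>Sj\<close> are nonzero.\<close>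
  have S0: "S 0 = (1 - q ^ n) / q ^ N"
  proof -
    have "S N = (\<Sum>k\<in>{N}. w k * wpoly q Q (Q ^ k) N)"
      unfolding S_def using nz wpoly_eq_0[of _ N Q q] by (intro sum.mono_neutral_right) auto
    then have SN: "S N = w N * (qpoch f Q N * qpoch (q * Q ^ N) Q N)"
      by (simp add: wpoly_def f_def)
    define R where "R = qpoch (q * Q / e) Q N"
    have R: "R \<noteq> 0" using ae by (simp add: R_def qpoch_eq_0_iff)
    define F where "F = qpoch (q * Q / f) Q N"
    have F: "F \<noteq> 0" using af by (simp add: F_def qpoch_eq_0_iff)
    have sh: "qpoch (q * Q ^ N) Q N * (1 - q * (Q ^ N)^2) = (1 - q ^ n) * F"
    proof -
      have "q * Q / f = q * Q ^ N * Q" by (simp add: f_def)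
      then show ?thesis
        using qpoch_shift[of "q * Q ^ N" Q N]
        by (simp add: F_def n_def power2_eq_square Qpow mult_ac)
    qed
    \<comment> \<open>The factorials at \<open>f\<close> and at \<open>q * Q / e\<close> are both
      reversed; their prefactors differ by \<open>q ^ N\<close>.\<close>
    have rev: "qpoch q Q N * qpoch f Q N * q ^ N = R * qpoch Q Q N"
    proof -
      have 1: "f = Q / (Q * Q ^ N)" using nz by (simp add: f_def)
      have 2: "q * Q / e = Q / (q * Q ^ N)"
        using q0 by (simp add: e_def Q_def field_simps power2_eq_square)
      have "(\<Prod>i<N. - 1 / (Q * Q ^ i)) * q ^ N = (\<Prod>i<N. - 1 / (q * Q ^ i))"
      proof -
        have "q ^ N = (\<Prod>i<N. q)" by simp
        then have "(\<Prod>i<N. - 1 / (Q * Q ^ i)) * q ^ N = (\<Prod>i<N. - 1 / (Q * Q ^ i) * q)"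
          by (simp only: prod.distrib)
        also have "\<dots> = (\<Prod>i<N. - 1 / (q * Q ^ i))"
          by (rule prod.cong) (use q0 in \<open>simp_all add: Q_def field_simps power2_eq_square\<close>)
        finally show ?thesis .
      qed
      moreover have "qpoch f Q N = qpoch Q Q N * (\<Prod>i<N. - 1 / (Q * Q ^ i))"
        unfolding 1 by (rule qpoch_reverse[OF nz(1) nz(1)])
      moreover have "R = qpoch q Q N * (\<Prod>i<N. - 1 / (q * Q ^ i))"
        unfolding R_def 2 by (rule qpoch_reverse[OF nz(1) q0])
      ultimately show ?thesis by (simp add: mult_ac)
    qed
    have "q * Q / q = Q" using q0 by simp
    moreover have "q * Q / (q * e * f) = 1" using q0 ef nz by (simp add: mult.assoc)
    ultimately have wN: "w N = (1 - q * (Q ^ N)^2) * (qpoch q Q N * qpoch q Q N * qpoch e Q N * qpoch f Q N)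
       / (qpoch Q Q N * qpoch Q Q N * R * F)"
      by (simp add: w_def R_def F_def)
    define qN eN fN QN where loc: "qN = qpoch q Q N" "eN = qpoch e Q N" "fN = qpoch f Q N" "QN = qpoch Q Q N"
    have ne: "qN \<noteq> 0" "eN \<noteq> 0" "fN \<noteq> 0" "QN \<noteq> 0" using qQ eQ fQ QQ by (simp_all add: loc)
    have "qN * eN * fN * S 0 = w N * (fN * qpoch (q * Q ^ N) Q N) * QN"
      unfolding loc Sj[of N, symmetric] SN ..
    also have "\<dots> = (qpoch (q * Q ^ N) Q N * (1 - q * (Q ^ N)^2)) * (qN * qN * eN * fN * fN) / (QN * R * F)"
      unfolding wN loc[symmetric] using ne by (simp add: mult_ac)
    also have "\<dots> = (1 - q ^ n) * (qN * qN * eN * fN * fN) / (QN * R)"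
      unfolding sh using F by simp
    also have "QN * R = qN * fN * q ^ N" using rev by (simp add: loc mult_ac)
    also have "(1 - q ^ n) * (qN * qN * eN * fN * fN) / \<dots> = qN * eN * fN * ((1 - q ^ n) / q ^ N)"
      using ne q0 by simp
    finally show ?thesis using ne by (metis mult_left_cancel no_zero_divisors)
  qed
  define V where "V j = qpoch (q * Q / (q * - q)) Q j * Q ^ j
       / (qpoch Q Q j * qpoch (q * Q / q) Q j * qpoch (q * Q / - q) Q j)" for j
  have par: "q * Q / q = Q" "q * Q / - q = - Q" "q * Q / (q * - q) = - q"
    using q0 by (simp_all add: Q_def power2_eq_square)
  have mQ: "- Q * Q ^ i \<noteq> 1" for i
  proof
    assume "- Q * Q ^ i = 1"
    then have "(- Q * Q ^ i) ^ 2 = 1" by simp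
    then have "Q ^ (2 * Suc i) = 1" by (simp add: power_mult_distrib power_mult[symmetric] mult.commute flip: power_add)
    then show False using Q1[of "2 * i + 1"] by simp
  qed
  have ratio: "poch_ratio (q ^ 2) k = qpoch q Q k * qpoch (- q) Q k / (qpoch Q Q k * qpoch (- Q) Q k)" for k
    unfolding poch_ratio_def qpoch_mult_minus by (simp add: Q_def)
  have L1: "(\<Sum>j\<le>N. wpoly q Q (Q ^ k) j * V j) = poch_ratio (q ^ 2) k * (- q) ^ k" if "k \<le> N" for k
  proof -
    have "(\<Sum>j\<le>N. wpoly q Q (Q ^ k) j * V j)
      = qpoch q Q k * qpoch (- q) Q k / (qpoch (q * Q / q) Q k * qpoch (q * Q / - q) Q k) * (q * Q / (q * - q)) ^ k"
      unfolding V_def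
    proof (rule q_pfaff_saalschuetz)
      show "q * Q / q * Q ^ i \<noteq> 1" for i using Q1[of i] par(1) by simp
      show "q * Q / - q * Q ^ i \<noteq> 1" for i using mQ[of i] unfolding par .
    qed (use that q0 nz Q1 a1 in auto)
    then show ?thesis by (simp only: par ratio)
  qed
  \<comment> \<open>Multiplying by \<open>1 - q\<close> turns \<open>[4 k + 1]\<close> into the
    very-well-poised factor \<open>1 - q * (Q ^ k)^2\<close> of \<open>w k\<close>.\<close>
  have main: "(- q) ^ k * qint q (4 * k + 1) * poch_ratio q k ^ 2 * shifted_ratio q n k * poch_ratio (q ^ 2) k * (1 - q)
     = w k * (\<Sum>j\<le>N. wpoly q Q (Q ^ k) j * V j)" if "k \<le> N" for k
  proof -
    have e_eq: "e = q ^ (2 * N + 2)"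
      unfolding e_def Qpow unfolding Q_def by (simp add: power2_eq_square)
    have f_eq: "f = 1 / q ^ (2 * N)" unfolding f_def Qpow ..
    have 1: "q ^ (n + 1) = e" by (simp add: e_eq n_def)
    have 2: "q / q ^ n = f" using q0 by (simp add: f_eq n_def)
    have 3: "q ^ (n + 2) = q * Q / f" by (simp add: f_eq n_def Q_def power2_eq_square mult_ac)
    have 4: "q ^ 2 / q ^ n = q * Q / e" using q0 by (simp add: e_eq n_def Q_def power2_eq_square)
    have 5: "qint q (4 * k + 1) * (1 - q) = 1 - q * (Q ^ k)^2"
      unfolding qint_eq by (simp add: Qpow power_mult[symmetric] mult_ac)
    have 6: "q * Q / (q * e * f) = 1" using q0 ef nz by (simp add: mult.assoc)
    have "w k = (qint q (4 * k + 1) * (1 - q)) * poch_ratio q k ^ 2 * shifted_ratio q n k"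
      unfolding w_def shifted_ratio_def poch_ratio_def 1 2 3 4 5 6 par
      by (simp add: power2_eq_square Q_def mult_ac)
    then show ?thesis unfolding L1[OF that] by (simp add: mult_ac)
  qed
  have andrews: "(\<Sum>j\<le>N. wpoly Q Q (Q ^ N) j * (qpoch Q (Q ^ 2) j * Q ^ j
       / (qpoch Q Q j * qpoch (Q * Q) (Q ^ 2) j * qpoch Q Q j)))
     = (if odd N then 0 else q ^ N * poch_ratio (q ^ 2) (N div 2) ^ 2)" (is "?g = _")
  proof -
    have "?g = (if odd N then 0 else Q ^ (N div 2) * (qpoch Q (Q ^ 2) (N div 2) * qpoch (Q * Q / Q) (Q ^ 2) (N div 2))
         / (qpoch (Q * Q) (Q ^ 2) (N div 2) * qpoch (Q * Q) (Q ^ 2) (N div 2)))"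
      by (rule andrews_sum) (use nz Q1 in \<open>simp_all flip: power_Suc\<close>)
    moreover have "Q * Q / Q = Q" "Q * Q = Q ^ 2" using nz by (simp_all add: power2_eq_square)
    moreover have "Q ^ (N div 2) = q ^ N" if "even N" using that by (simp add: Qpow)
    ultimately show ?thesis by (simp add: poch_ratio_def power2_eq_square Q_def)
  qed
  \<comment> \<open>\<open>(q; Q)_j\<close> from \<open>S j\<close> and \<open>(- q; Q)_j\<close>
    from \<open>V j\<close> combine to \<open>(Q; Q^2)_j\<close>, and \<open>(Q; Q)_j\<close> with
    \<open>(- Q; Q)_j\<close> to \<open>(Q^2; Q^2)_j\<close>. The result is the summand of
    \<open>andrews_sum\<close> in base \<open>Q\<close> with both parameters equal to
    \<open>Q\<close>.\<close>
  have VS: "V j * S j = S 0 * (wpoly Q Q (Q ^ N) j * (qpoch Q (Q ^ 2) j * Q ^ j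
       / (qpoch Q Q j * qpoch (Q * Q) (Q ^ 2) j * qpoch Q Q j)))" for j
  proof -
    have 1: "S j = qpoch q Q j * qpoch e Q j * qpoch f Q j * S 0 / qpoch Q Q j"
      using Sj[of j] QQ[of j] by (simp add: nonzero_eq_divide_eq)
    have 2: "wpoly Q Q (Q ^ N) j = qpoch f Q j * qpoch e Q j" by (simp add: wpoly_def e_def f_def)
    have 3: "qpoch Q (Q ^ 2) j = qpoch q Q j * qpoch (- q) Q j" by (simp add: qpoch_mult_minus Q_def)
    have 4: "qpoch (Q * Q) (Q ^ 2) j = qpoch Q Q j * qpoch (- Q) Q j"
      by (simp add: qpoch_mult_minus power2_eq_square)
    show ?thesis unfolding V_def par 1 2 3 4 by (simp add: mult_ac)
  qed
  let ?T = "\<Sum>k\<le>N. (- q) ^ k * qint q (4 * k + 1) * poch_ratio q k ^ 2 * shifted_ratio q n k * poch_ratio (q ^ 2) k"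
  have "?T * (1 - q) = (\<Sum>k\<le>N. w k * (\<Sum>j\<le>N. wpoly q Q (Q ^ k) j * V j))"
    unfolding sum_distrib_right by (rule sum.cong) (use main in auto)
  also have "\<dots> = (\<Sum>j\<le>N. V j * S j)"
    unfolding S_def sum_distrib_left by (subst sum.swap) (simp add: mult_ac)
  also have "\<dots> = S 0 * ?g"
    unfolding VS sum_distrib_left ..
  also have "\<dots> = (if odd N then 0 else qint q n * poch_ratio (q ^ 2) (N div 2) ^ 2) * (1 - q)"
    unfolding andrews S0 using q0 by (simp add: qint_eq[symmetric])
  finally show ?thesis using q1[of 0] by simp
qed


section \<open>Cyclotomic polynomials and congruences\<close>

text \<open>A nonconstant gcd has a complex root by the fundamental theorem of algebra, and a zero
  gcd has every number as a root; either root is shared by both polynomials.\<close>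

lemma coprime_if_no_common_complex_root:
  fixes p r :: "rat poly"
  assumes "\<And>z::complex. poly (map_poly of_rat p) z = 0 \<Longrightarrow> poly (map_poly of_rat r) z \<noteq> 0"
  shows "coprime p r"
proof (rule ccontr)
  let ?h = "map_poly of_rat :: rat poly \<Rightarrow> complex poly"
  assume "\<not> coprime p r"
  then have nu: "\<not> is_unit (gcd p r)" using is_unit_gcd by blast
  have root: "\<exists>z. poly (?h (gcd p r)) z = 0"
  proof (cases "gcd p r = 0")
    case False
    then have "degree (gcd p r) > 0" using nu is_unit_iff_degree[of "gcd p r"] by blast
    then have "degree (?h (gcd p r)) > 0" by (simp add: degree_map_poly)
    then show ?thesis by (intro fundamental_theorem_of_algebra) (simp add: constant_degree)
  qed simp
  then obtain z where z: "poly (?h (gcd p r)) z = 0" by blast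
  have "poly (?h s) z = 0" if "gcd p r dvd s" for s
    using that z by (auto simp: dvd_def map_poly_of_rat_mult)
  then show False using assms[of z] by simp
qed

section \<open>Cyclotomic polynomials: roots, factorizations and coprimality\<close>

lemma primitive_root_power_eq_1_iff:
  assumes "z \<in> primitive_roots_unity d" "d > 0"
  shows "z ^ m = 1 \<longleftrightarrow> d dvd m"
proof
  assume "z ^ m = 1"
  have "z ^ m = z ^ (d * (m div d) + m mod d)" by simp
  also have "\<dots> = z ^ (m mod d)"
    using assms(1) unfolding power_add power_mult by (simp add: primitive_roots_unity_def)
  finally have "z ^ (m mod d) = 1" using \<open>z ^ m = 1\<close> by simp
  then show "d dvd m"
    using assms by (cases "m mod d = 0") (auto simp: primitive_roots_unity_def dvd_eq_mod_eq_0)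
qed (use assms in \<open>auto simp: primitive_roots_unity_def dvd_def power_mult\<close>)

lemma poly_cyclotomic_eq_0_iff:
  assumes "d > 0"
  shows "poly (map_poly of_rat (cyclotomic d)) z = 0 \<longleftrightarrow> z \<in> primitive_roots_unity d"
  using finite_primitive_roots_unity[OF assms]
  by (auto simp: of_rat_cyclotomic[OF assms] poly_prod)

lemma map_poly_of_rat_1: "(map_poly of_rat 1 :: complex poly) = 1"
  by simp

lemma map_poly_of_rat_polyq: "(map_poly of_rat polyq :: complex poly) = [:0, 1:]"
  by (simp add: map_poly_pCons)

lemma map_poly_of_rat_power: "(map_poly of_rat (p ^ m) :: complex poly) = map_poly of_rat p ^ m"
  by (induction m) (simp_all add: map_poly_of_rat_mult)

lemma map_poly_of_rat_diff:
  "(map_poly of_rat (p - r) :: complex poly) = map_poly of_rat p - map_poly of_rat r"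
  by (rule poly_eqI) (simp add: coeff_map_poly of_rat_diff)

lemma map_poly_of_rat_sum:
  "(map_poly of_rat (\<Sum>i\<in>A. f i) :: complex poly) = (\<Sum>i\<in>A. map_poly of_rat (f i))"
  by (induction A rule: infinite_finite_induct) (simp_all add: map_poly_of_rat_add)

lemmas map_poly_of_rat_hom = map_poly_of_rat_mult map_poly_of_rat_add map_poly_of_rat_diff
  map_poly_of_rat_power map_poly_of_rat_sum map_poly_of_rat_prod map_poly_of_rat_polyq map_poly_of_rat_1

lemma power_minus_1_eq_prod_cyclotomic:
  assumes "n > 0"
  shows "polyq ^ n - 1 = (\<Prod>d | d dvd n. cyclotomic d)"
proof (rule map_poly_of_rat_inj)
  have "[:0, 1:] ^ n = (monom 1 n :: complex poly)"
    by (simp add: monom_altdef)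
  then have "map_poly of_rat (polyq ^ n - 1) = (monom 1 n - 1 :: complex poly)"
    by (simp only: map_poly_of_rat_hom)
  also have "\<dots> = (\<Prod>d | d dvd n. \<Prod>z\<in>primitive_roots_unity d. [:- z, 1:])"
    by (rule power_minus_1_eq_prod_primitive[OF assms])
  also have "\<dots> = map_poly of_rat (\<Prod>d | d dvd n. cyclotomic d)"
    unfolding map_poly_of_rat_prod
    by (rule prod.cong) (use assms in \<open>auto simp: of_rat_cyclotomic dvd_pos_nat\<close>)
  finally show "map_poly of_rat (polyq ^ n - 1) = (map_poly of_rat (\<Prod>d | d dvd n. cyclotomic d) :: complex poly)" .
qed

text \<open>The factorization of \<open>q^n - 1\<close> is divided by
  \<open>cyclotomic 1 = q - 1\<close>.\<close>

lemma qint_eq_prod_cyclotomic: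
  assumes "n > 0"
  shows "qint polyq n = (\<Prod>d | d dvd n \<and> d \<noteq> 1. cyclotomic d)"
proof -
  have fin: "finite {d. d dvd n \<and> d \<noteq> 1}"
    using assms by (auto intro: finite_subset[of _ "{d. d dvd n}"])
  have "{d. d dvd n} = insert 1 {d. d dvd n \<and> d \<noteq> 1}" by auto
  then have "(polyq ^ n - 1) = cyclotomic 1 * (\<Prod>d | d dvd n \<and> d \<noteq> 1. cyclotomic d)"
    unfolding power_minus_1_eq_prod_cyclotomic[OF assms] using fin by simp
  moreover have "cyclotomic 1 = polyq - 1"
    using power_minus_1_eq_prod_cyclotomic[of 1] by simp
  ultimately have "qint polyq n * (polyq - 1) = (\<Prod>d | d dvd n \<and> d \<noteq> 1. cyclotomic d) * (polyq - 1)"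
  proof -
    have "qint polyq n * (polyq - 1) = - (qint polyq n * (1 - polyq))"
      by (simp only: right_diff_distrib minus_diff_eq)
    also have "\<dots> = polyq ^ n - 1" unfolding qint_eq by simp
    finally show ?thesis using \<open>cyclotomic 1 = polyq - 1\<close>
      \<open>polyq ^ n - 1 = cyclotomic 1 * (\<Prod>d | d dvd n \<and> d \<noteq> 1. cyclotomic d)\<close>
      by (simp only: mult.commute)
  qed
  moreover have "polyq - 1 \<noteq> 0" by (simp add: one_pCons)
  ultimately show ?thesis by (metis mult_right_cancel)
qed

lemma cyclotomic_dvd:
  assumes "d > 0" "d dvd m"
  shows "cyclotomic d dvd 1 - polyq ^ m"
proof (cases "m = 0")
  case False
  then have "cyclotomic d dvd polyq ^ m - 1"
    using assms by (auto simp: power_minus_1_eq_prod_cyclotomic intro!: dvd_prodI)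
  then show ?thesis by (simp add: dvd_diff_commute)
qed simp

lemma coprime_cyclotomic_1_minus_power:
  assumes "d > 0" "\<not> d dvd m"
  shows "coprime (1 - polyq ^ m) (cyclotomic d)"
  by (rule coprime_if_no_common_complex_root)
     (use assms in \<open>simp add: poly_cyclotomic_eq_0_iff map_poly_of_rat_hom\<close>,
      use assms primitive_root_power_eq_1_iff in \<open>fastforce\<close>)

lemma coprime_cyclotomic_polyq: "d > 0 \<Longrightarrow> coprime polyq (cyclotomic d)"
  by (rule coprime_if_no_common_complex_root)
     (auto simp: poly_cyclotomic_eq_0_iff map_poly_of_rat_hom primitive_roots_unity_def power_0_left)

text \<open>At a root of \<open>cyclotomic d\<close> the power \<open>q ^ (d * l)\<close> is 1, so
  the \<open>q\<close>-integer takes the nonzero value \<open>m\<close>.\<close>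

lemma coprime_cyclotomic_qint:
  assumes "d > 0" "m > 0"
  shows "coprime (qint (polyq ^ (d * l)) m) (cyclotomic d)"
proof (rule coprime_if_no_common_complex_root, rule notI)
  fix z :: complex
  assume *: "poly (map_poly of_rat (qint (polyq ^ (d * l)) m)) z = 0"
    and "poly (map_poly of_rat (cyclotomic d)) z = 0"
  then have "z ^ d = 1" using assms by (simp add: poly_cyclotomic_eq_0_iff primitive_roots_unity_def)
  then have "poly (map_poly of_rat (qint (polyq ^ (d * l)) m)) z = of_nat m"
    by (simp add: qint_def map_poly_of_rat_hom poly_sum power_mult)
  with * assms show False by simp
qed

lemma coprime_cyclotomics:
  assumes "d > 0" "e > 0" "d \<noteq> e"
  shows "coprime (cyclotomic d) (cyclotomic e)"
proof (rule coprime_if_no_common_complex_root, rule notI)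
  fix z :: complex
  assume "poly (map_poly of_rat (cyclotomic d)) z = 0" "poly (map_poly of_rat (cyclotomic e)) z = 0"
  then have "z \<in> primitive_roots_unity d" "z \<in> primitive_roots_unity e"
    using assms by (simp_all add: poly_cyclotomic_eq_0_iff)
  then have "d dvd m \<longleftrightarrow> e dvd m" for m
    using assms primitive_root_power_eq_1_iff by blast
  then show False using \<open>d \<noteq> e\<close> by (meson dvd_antisym dvd_refl)
qed

section \<open>The local ring of fractions with denominators coprime to \<open>P\<close>\<close>

definition integral_at :: "rat poly \<Rightarrow> rat poly fract \<Rightarrow> bool"
  where "integral_at P A \<longleftrightarrow> (\<exists>U V. V \<noteq> 0 \<and> coprime V P \<and> A = to_fract U / to_fract V)"

lemma integral_at_to_fract [intro]: "integral_at P (to_fract U)"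
  unfolding integral_at_def by (rule exI[of _ U], rule exI[of _ 1]) simp

lemma integral_at_0 [simp]: "integral_at P 0" and integral_at_1 [simp]: "integral_at P 1"
  using integral_at_to_fract[of P 0] integral_at_to_fract[of P 1] by simp_all

lemma integral_at_inverse: "V \<noteq> 0 \<Longrightarrow> coprime V P \<Longrightarrow> integral_at P (1 / to_fract V)"
  unfolding integral_at_def by (metis to_fract_1)

lemma integral_at_mult [intro]:
  assumes "integral_at P A" "integral_at P B" shows "integral_at P (A * B)"
proof -
  obtain U V U' V' where "V \<noteq> 0" "coprime V P" "A = to_fract U / to_fract V"
    "V' \<noteq> 0" "coprime V' P" "B = to_fract U' / to_fract V'"
    using assms unfolding integral_at_def by blast
  then show ?thesis unfolding integral_at_def
    by (rule_tac exI[of _ "U * U'"], rule_tac exI[of _ "V * V'"]) simp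
qed

lemma integral_at_add [intro]:
  assumes "integral_at P A" "integral_at P B" shows "integral_at P (A + B)"
proof -
  obtain U V U' V' where "V \<noteq> 0" "coprime V P" "A = to_fract U / to_fract V"
    "V' \<noteq> 0" "coprime V' P" "B = to_fract U' / to_fract V'"
    using assms unfolding integral_at_def by blast
  then show ?thesis unfolding integral_at_def
    by (rule_tac exI[of _ "U * V' + U' * V"], rule_tac exI[of _ "V * V'"]) (simp add: field_simps)
qed

lemma integral_at_minus [intro]: "integral_at P A \<Longrightarrow> integral_at P (- A)"
  using integral_at_mult[OF integral_at_to_fract[of P "- 1"], of A] by simp

lemma integral_at_diff [intro]: "integral_at P A \<Longrightarrow> integral_at P B \<Longrightarrow> integral_at P (A - B)"
  using integral_at_add[of P A "- B"] by auto

lemma integral_at_power [intro]: "integral_at P A \<Longrightarrow> integral_at P (A ^ k)"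
  by (induction k) auto

lemma integral_at_sum: "(\<And>i. i \<in> I \<Longrightarrow> integral_at P (f i)) \<Longrightarrow> integral_at P (sum f I)"
  by (induction I rule: infinite_finite_induct) auto

lemma integral_at_prod: "(\<And>i. i \<in> I \<Longrightarrow> integral_at P (f i)) \<Longrightarrow> integral_at P (prod f I)"
  by (induction I rule: infinite_finite_induct) auto

text \<open>A positive power of \<open>P\<close> admits the same coprime denominators as
  \<open>P\<close>, so one ring serves for all exponents.\<close>

lemma ratfun_cong_power_iff:
  assumes "k > 0"
  shows "ratfun_cong A B (P ^ k) \<longleftrightarrow> (\<exists>X. integral_at P X \<and> A - B = to_fract P ^ k * X)"
proof -
  have 1: "to_fract (P ^ k) = to_fract P ^ k" by (induction k) simp_all
  have 2: "coprime V (P ^ k) \<longleftrightarrow> coprime V P" for V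
    using assms by (simp add: coprime_power_right_iff)
  show ?thesis unfolding ratfun_cong_def integral_at_def 1 2 by blast
qed

section \<open>Calculus of congruences in this ring\<close>

lemma ratfun_congI: "k > 0 \<Longrightarrow> integral_at P X \<Longrightarrow> A - B = to_fract P ^ k * X \<Longrightarrow> ratfun_cong A B (P ^ k)"
  using ratfun_cong_power_iff by blast

lemma ratfun_cong_refl [simp]: "ratfun_cong A A P"
  unfolding ratfun_cong_def by (intro exI[of _ 0] exI[of _ 1]) simp

lemma ratfun_cong_iff:
  "ratfun_cong A B P \<longleftrightarrow> (\<exists>X. integral_at P X \<and> A - B = to_fract P * X)"
  using ratfun_cong_power_iff[of 1 A B P] by simp

lemma ratfun_cong_sym:
  assumes "ratfun_cong A B P" shows "ratfun_cong B A P"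
proof -
  obtain X where X: "integral_at P X" "A - B = to_fract P * X"
    using assms unfolding ratfun_cong_iff by blast
  have "B - A = - (A - B)" by simp
  also have "\<dots> = to_fract P * (- X)" unfolding X by simp
  finally show ?thesis using integral_at_minus[OF X(1)] unfolding ratfun_cong_iff by metis
qed

lemma ratfun_cong_trans [trans]:
  assumes "ratfun_cong A B P" "ratfun_cong B C P" shows "ratfun_cong A C P"
proof -
  obtain X Y where "integral_at P X" "A - B = to_fract P * X" "integral_at P Y" "B - C = to_fract P * Y"
    using assms unfolding ratfun_cong_iff by blast
  moreover have "A - C = (A - B) + (B - C)" by simp
  ultimately have "integral_at P (X + Y) \<and> A - C = to_fract P * (X + Y)"
    by (simp add: integral_at_add distrib_left)
  then show ?thesis unfolding ratfun_cong_iff ..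
qed

lemma ratfun_cong_add:
  assumes "ratfun_cong A B P" "ratfun_cong C D P" shows "ratfun_cong (A + C) (B + D) P"
proof -
  obtain X Y where "integral_at P X" "A - B = to_fract P * X" "integral_at P Y" "C - D = to_fract P * Y"
    using assms unfolding ratfun_cong_iff by blast
  moreover have "(A + C) - (B + D) = (A - B) + (C - D)" by simp
  ultimately have "integral_at P (X + Y) \<and> (A + C) - (B + D) = to_fract P * (X + Y)"
    by (simp add: integral_at_add distrib_left)
  then show ?thesis unfolding ratfun_cong_iff ..
qed

lemma ratfun_cong_sum:
  "(\<And>i. i \<in> I \<Longrightarrow> ratfun_cong (f i) (g i) P) \<Longrightarrow> ratfun_cong (sum f I) (sum g I) P"
  by (induction I rule: infinite_finite_induct) (simp_all add: ratfun_cong_add)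

text \<open>Congruent fractions may share a pole, so some integrality has to be assumed; the
  splitting \<open>A * (C - D) + (A - B) * D\<close> of the difference asks for it at
  \<open>A\<close> and \<open>D\<close>.\<close>

lemma ratfun_cong_mult:
  assumes "ratfun_cong A B P" "ratfun_cong C D P" "integral_at P A" "integral_at P D"
  shows "ratfun_cong (A * C) (B * D) P"
proof -
  obtain X Y where *: "integral_at P X" "A - B = to_fract P * X" "integral_at P Y" "C - D = to_fract P * Y"
    using assms unfolding ratfun_cong_iff by blast
  have "A * C - B * D = A * (C - D) + (A - B) * D" by (simp add: algebra_simps)
  also have "\<dots> = to_fract P * (A * Y + X * D)" unfolding * by (simp add: algebra_simps)
  finally have "A * C - B * D = to_fract P * (A * Y + X * D)" .
  moreover have "integral_at P (A * Y + X * D)"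
    using assms * by (intro integral_at_add integral_at_mult)
  ultimately show ?thesis unfolding ratfun_cong_iff by metis
qed

lemma ratfun_cong_prod:
  assumes "\<And>i. i \<in> I \<Longrightarrow> ratfun_cong (f i) (g i) P"
    "\<And>i. i \<in> I \<Longrightarrow> integral_at P (f i)" "\<And>i. i \<in> I \<Longrightarrow> integral_at P (g i)"
  shows "ratfun_cong (prod f I) (prod g I) P"
  using assms
  by (induction I rule: infinite_finite_induct) (auto intro!: ratfun_cong_mult integral_at_prod)

lemma ratfun_cong_power:
  "ratfun_cong A B P \<Longrightarrow> integral_at P A \<Longrightarrow> integral_at P B \<Longrightarrow> ratfun_cong (A ^ k) (B ^ k) P"
  using ratfun_cong_prod[of "{..<k}" "\<lambda>_. A" "\<lambda>_. B" P] by simp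

lemma ratfun_cong_sum_subset:
  assumes "finite I" "J \<subseteq> I" "\<And>i. i \<in> I - J \<Longrightarrow> ratfun_cong (f i) 0 P"
  shows "ratfun_cong (sum f I) (sum f J) P"
proof -
  have "ratfun_cong (sum f (I - J)) (\<Sum>i\<in>I - J. 0) P"
    by (rule ratfun_cong_sum) (use assms in auto)
  then have "ratfun_cong (sum f (I - J) + sum f J) (0 + sum f J) P"
    by (intro ratfun_cong_add) simp_all
  then show ?thesis using sum.subset_diff[OF assms(2,1), of f] by simp
qed

text \<open>
  The denominators witnessing the two congruences may differ, so the proof passes to the fraction
  \<open>A - B\<close> in lowest terms.
\<close>

lemma ratfun_cong_coprime_mult:
  assumes "ratfun_cong A B P" "ratfun_cong A B R" "coprime P R"
  shows "ratfun_cong A B (P * R)"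
proof -
  define a b where "a = fst (quot_of_fract (A - B))" and "b = snd (quot_of_fract (A - B))"
  have "A - B = Fract a b" unfolding a_def b_def by (rule Fract_quot_of_fract[symmetric])
  then have ab: "A - B = to_fract a / to_fract b" "b \<noteq> 0" "coprime a b"
    unfolding a_def b_def
    by (simp_all only: Fract_conv_to_fract snd_quot_of_fract_nonzero coprime_quot_of_fract simp_thms)
  have dvd: "P dvd a \<and> coprime b P" if cong: "ratfun_cong A B P" for P
  proof -
    obtain U V where "V \<noteq> 0" and co: "coprime V P" and eq: "A - B = to_fract P * (to_fract U / to_fract V)"
      using cong unfolding ratfun_cong_def by blast
    have "to_fract (a * V) = to_fract (P * U * b)"
      using eq ab \<open>V \<noteq> 0\<close> by (simp add: field_simps)
    then have *: "a * V = P * U * b" by (simp only: to_fract_eq_iff)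
    then have "P dvd a * V" by (metis dvd_triv_left mult.assoc)
    then have Pa: "P dvd a" using coprime_dvd_mult_left_iff[of P V a] co by (metis coprime_commute)
    have "coprime b a" using ab(3) coprime_commute by blast
    then have "coprime b P" using coprime_divisors[OF dvd_refl Pa] by blast
    then show ?thesis using Pa by blast
  qed
  have "P dvd a" "R dvd a" "coprime b P" "coprime b R" using dvd assms(1,2) by blast+
  then have "P * R dvd a" "coprime b (P * R)"
    using assms(3) by (auto intro: divides_mult)
  then obtain W where "a = P * R * W" by blast
  then have "A - B = to_fract (P * R) * (to_fract W / to_fract b)" using ab(1) by simp
  then show ?thesis using ab(2) \<open>coprime b (P * R)\<close> unfolding ratfun_cong_def by blast
qed

text \<open>Induction over the index set; the congruence modulo \<open>1\<close> starts it at the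
  empty product.\<close>

lemma ratfun_cong_coprime_prod:
  assumes "finite I" "\<And>i. i \<in> I \<Longrightarrow> ratfun_cong A B (P i)"
    "\<And>i j. i \<in> I \<Longrightarrow> j \<in> I \<Longrightarrow> i \<noteq> j \<Longrightarrow> coprime (P i) (P j)" "ratfun_cong A B 1"
  shows "ratfun_cong A B (\<Prod>i\<in>I. P i)"
  using assms
proof (induction I rule: finite_induct)
  case (insert i I)
  have "coprime (P i) (\<Prod>i\<in>I. P i)" using insert by (intro prod_coprime_right) auto
  moreover have "ratfun_cong A B (\<Prod>i\<in>I. P i)" using insert by blast
  ultimately show ?case using insert by (simp add: ratfun_cong_coprime_mult)
qed simp

lemma ratfun_cong_dvd:
  assumes "ratfun_cong A B P" "R dvd P"
  shows "ratfun_cong A B R"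
proof -
  obtain U V where *: "V \<noteq> 0" "coprime V P" "A - B = to_fract P * (to_fract U / to_fract V)"
    using assms unfolding ratfun_cong_def by blast
  obtain S where S: "P = R * S" using assms by blast
  have "A - B = to_fract R * (to_fract (S * U) / to_fract V)" "coprime V R"
    using * S by simp_all
  then show ?thesis using *(1) unfolding ratfun_cong_def by blast
qed

lemma integral_at_power_iff: "k > 0 \<Longrightarrow> integral_at (P ^ k) A \<longleftrightarrow> integral_at P A"
  unfolding integral_at_def by (simp add: coprime_power_right_iff)

lemma ratfun_cong_inverse:
  assumes "ratfun_cong A B P" "integral_at P (1 / A)" "integral_at P (1 / B)" "A \<noteq> 0" "B \<noteq> 0"
  shows "ratfun_cong (1 / A) (1 / B) P"
proof -
  obtain X where X: "integral_at P X" "A - B = to_fract P * X"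
    using assms(1) unfolding ratfun_cong_iff by blast
  have "1 / A - 1 / B = - (A - B) * (1 / A) * (1 / B)" using assms(4,5) by (simp add: field_simps)
  also have "\<dots> = to_fract P * (- X * (1 / A) * (1 / B))" unfolding X by simp
  finally have "1 / A - 1 / B = to_fract P * (- X * (1 / A) * (1 / B))" .
  moreover have "integral_at P (- X * (1 / A) * (1 / B))"
    using X(1) assms(2,3) by (intro integral_at_mult integral_at_minus)
  ultimately show ?thesis unfolding ratfun_cong_iff by metis
qed


section \<open>Reduction modulo cyclotomic polynomials\<close>

lemma to_fract_power: "to_fract (p ^ k) = to_fract p ^ k" for p :: "'a::idom"
  by (induction k) simp_all

lemma to_fract_qint: "to_fract (qint p m) = qint (to_fract p) m" for p :: "'a::idom"
  by (induction m) (simp_all add: qint_def to_fract_power)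

lemma one_minus_ratq_power: "1 - ratq ^ i = to_fract (1 - polyq ^ i)"
  by (simp add: to_fract_power)

lemma polyq_power_neq_1: "i > 0 \<Longrightarrow> 1 - polyq ^ i \<noteq> 0"
proof
  assume "i > 0" "1 - polyq ^ i = 0"
  then have "poly (1 - polyq ^ i) 0 = 0" by simp
  then show False using \<open>i > 0\<close> by (simp add: poly_power power_0_left)
qed

lemma ratq_nonzero [simp]: "ratq \<noteq> 0"
  by simp

lemma ratq_power_neq_1: "i > 0 \<Longrightarrow> 1 - ratq ^ i \<noteq> 0"
  unfolding one_minus_ratq_power using polyq_power_neq_1 by (simp only: to_fract_eq_0_iff not_False_eq_True)

lemma integral_at_ratq_power: "integral_at P (ratq ^ i)"
  by (intro integral_at_power integral_at_to_fract)

lemma integral_at_one_minus_ratq_power: "integral_at P (1 - ratq ^ i)"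
  unfolding one_minus_ratq_power by (rule integral_at_to_fract)

lemma integral_at_inverse_one_minus:
  assumes "d > 0" "\<not> d dvd m"
  shows "integral_at (cyclotomic d) (1 / (1 - ratq ^ m))"
proof -
  have "m > 0" using assms(2) by (cases "m = 0") auto
  then show ?thesis unfolding one_minus_ratq_power
    using assms by (intro integral_at_inverse coprime_cyclotomic_1_minus_power polyq_power_neq_1)
qed

lemma integral_at_inverse_ratq_power:
  assumes "d > 0"
  shows "integral_at (cyclotomic d) (1 / ratq ^ m)"
proof -
  have "integral_at (cyclotomic d) ((1 / ratq) ^ m)"
    using assms by (intro integral_at_power integral_at_inverse coprime_cyclotomic_polyq) simp_all
  then show ?thesis by (simp add: power_one_over)
qed

lemma ratfun_cong_one_minus_ratq_power:
  assumes "d > 0" "d dvd m"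
  shows "ratfun_cong (1 - ratq ^ m) 0 (cyclotomic d)"
proof -
  obtain W where W: "1 - polyq ^ m = cyclotomic d * W"
    using cyclotomic_dvd[OF assms] by blast
  have "1 - ratq ^ m - 0 = to_fract (cyclotomic d) * to_fract W"
    unfolding one_minus_ratq_power W by simp
  then show ?thesis unfolding ratfun_cong_iff using integral_at_to_fract by blast
qed

text \<open>Exponents matter only modulo \<open>d\<close>, because the two sides differ by a
  multiple of \<open>1 - q ^ m\<close>.\<close>

lemma ratfun_cong_ratq_power_add:
  assumes "d > 0" "d dvd m"
  shows "ratfun_cong (1 - ratq ^ (i + m)) (1 - ratq ^ i) (cyclotomic d)"
proof -
  have "ratfun_cong (ratq ^ i * (1 - ratq ^ m)) (ratq ^ i * 0) (cyclotomic d)"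
    using assms by (intro ratfun_cong_mult ratfun_cong_one_minus_ratq_power integral_at_ratq_power) simp_all
  then have "ratfun_cong (ratq ^ i * (1 - ratq ^ m) + (1 - ratq ^ i)) (ratq ^ i * 0 + (1 - ratq ^ i)) (cyclotomic d)"
    by (intro ratfun_cong_add) simp_all
  then show ?thesis by (simp add: algebra_simps power_add)
qed

section \<open>Lucas-type congruences for the ratios and for \<open>c_q\<close>\<close>

lemma poch_ratio_eq_prod:
  "poch_ratio x k = (\<Prod>i<k. (1 - x ^ (2 * i + 1)) / (1 - x ^ (2 * i + 2)))"
proof -
  have "x ^ (2 * i + 1) = x * (x ^ 2) ^ i" "x ^ (2 * i + 2) = x ^ 2 * (x ^ 2) ^ i" for i
    unfolding power_mult[of x 2 i, symmetric] by (simp_all add: power2_eq_square)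
  then show ?thesis unfolding poch_ratio_def qpoch_def prod_dividef by (simp only:)
qed

lemma poch_ratio_add:
  "poch_ratio x (k + m) = poch_ratio x k
     * (\<Prod>i<m. (1 - x ^ (2 * (k + i) + 1)) / (1 - x ^ (2 * (k + i) + 2)))"
  by (induction m) (simp_all add: poch_ratio_eq_prod)

text \<open>As \<open>d\<close> is odd and prime to \<open>e\<close>, divisibility would reduce to
  \<open>d dvd Suc i\<close>. Thus in a block of \<open>d\<close> factors only the last denominator,
  at \<open>i = d - 1\<close>, fails to be invertible.\<close>

lemma not_dvd_denominator:
  assumes "odd d" "coprime e d" "Suc i < d"
  shows "\<not> d dvd e * (2 * (a * d + i) + 2)"
proof
  assume "d dvd e * (2 * (a * d + i) + 2)"
  then have "d dvd 2 * (a * d + i) + 2"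
    using assms(2) by (metis coprime_dvd_mult_right_iff coprime_commute)
  then have "d dvd 2 * (a * d + Suc i)" by simp
  moreover have "coprime d 2" using assms(1) by simp
  ultimately have "d dvd a * d + Suc i" by (metis coprime_dvd_mult_right_iff)
  then have "d dvd Suc i" by (metis dvd_add_right_iff dvd_triv_right)
  then show False using assms(3) by (simp add: dvd_imp_le nat_dvd_not_less)
qed

text \<open>Corresponding exponents in block \<open>a\<close> and in block \<open>0\<close> differ
  by a multiple of \<open>d\<close>. The bound \<open>r < d\<close> leaves out the last factor of
  the block, whose denominator is not invertible.\<close>

lemma poch_ratio_shift_cong:
  assumes "odd d" "coprime e d" "r < d"
  shows "ratfun_cong (\<Prod>i<r. (1 - (ratq ^ e) ^ (2 * (a * d + i) + 1)) / (1 - (ratq ^ e) ^ (2 * (a * d + i) + 2)))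
      (poch_ratio (ratq ^ e) r) (cyclotomic d)" (is ?c)
    and "integral_at (cyclotomic d)
      (\<Prod>i<r. (1 - (ratq ^ e) ^ (2 * (a * d + i) + 1)) / (1 - (ratq ^ e) ^ (2 * (a * d + i) + 2)))" (is ?i)
proof -
  have d: "d > 0" using assms by simp
  have num: "integral_at (cyclotomic d) (1 - (ratq ^ e) ^ j)" for j
    unfolding power_mult[symmetric] by (rule integral_at_one_minus_ratq_power)
  have den: "integral_at (cyclotomic d) (1 / (1 - (ratq ^ e) ^ (2 * (a * d + i) + 2)))"
    if "i < r" for i a
    unfolding power_mult[symmetric]
    using that assms by (intro integral_at_inverse_one_minus[OF d] not_dvd_denominator) auto
  have nz: "1 - (ratq ^ e) ^ (2 * (a * d + i) + 2) \<noteq> 0" if "i < r" for i a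
  proof -
    have "e * (2 * (a * d + i) + 2) > 0"
      using not_dvd_denominator[OF assms(1,2), of i a] that assms(3) by (intro Nat.gr0I) auto
    then show ?thesis unfolding power_mult[symmetric] by (rule ratq_power_neq_1)
  qed
  have int: "integral_at (cyclotomic d) ((1 - (ratq ^ e) ^ (2 * (a * d + i) + 1)) / (1 - (ratq ^ e) ^ (2 * (a * d + i) + 2)))"
    if "i < r" for i a
    using integral_at_mult[OF num den[OF that], of "2 * (a * d + i) + 1" a] by simp
  then show ?i by (intro integral_at_prod) simp
  have cong: "ratfun_cong (1 - (ratq ^ e) ^ (2 * (a * d + i) + j)) (1 - (ratq ^ e) ^ (2 * i + j)) (cyclotomic d)" for i j
  proof -
    have "e * (2 * (a * d + i) + j) = e * (2 * i + j) + e * (2 * a) * d" by (simp add: algebra_simps)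
    then show ?thesis unfolding power_mult[symmetric]
      using ratfun_cong_ratq_power_add[OF d, of "e * (2 * a) * d" "e * (2 * i + j)"] by simp
  qed
  show ?c unfolding poch_ratio_eq_prod
  proof (rule ratfun_cong_prod)
    fix i assume "i \<in> {..<r}"
    then have i: "i < r" by simp
    have den0: "integral_at (cyclotomic d) (1 / (1 - (ratq ^ e) ^ (2 * i + 2)))" using den[OF i, of 0] by simp
    have nz0: "1 - (ratq ^ e) ^ (2 * i + 2) \<noteq> 0" using nz[OF i, of 0] by simp
    have "ratfun_cong ((1 - (ratq ^ e) ^ (2 * (a * d + i) + 1)) * (1 / (1 - (ratq ^ e) ^ (2 * (a * d + i) + 2))))
       ((1 - (ratq ^ e) ^ (2 * i + 1)) * (1 / (1 - (ratq ^ e) ^ (2 * i + 2)))) (cyclotomic d)"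
      by (intro ratfun_cong_mult cong ratfun_cong_inverse den[OF i] den0 nz[OF i] nz0 num)
    then show "ratfun_cong ((1 - (ratq ^ e) ^ (2 * (a * d + i) + 1)) / (1 - (ratq ^ e) ^ (2 * (a * d + i) + 2)))
       ((1 - (ratq ^ e) ^ (2 * i + 1)) / (1 - (ratq ^ e) ^ (2 * i + 2))) (cyclotomic d)"
      by simp
    show "integral_at (cyclotomic d) ((1 - (ratq ^ e) ^ (2 * (a * d + i) + 1)) / (1 - (ratq ^ e) ^ (2 * (a * d + i) + 2)))"
      using int[OF i] .
    show "integral_at (cyclotomic d) ((1 - (ratq ^ e) ^ (2 * i + 1)) / (1 - (ratq ^ e) ^ (2 * i + 2)))"
      using int[OF i, of 0] by simp
  qed
qed

text \<open>
  In each block of \<open>d = 2 h + 1\<close> consecutive factors, exactly one numerator (at \<open>h\<close>) and one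
  denominator (at \<open>2 h\<close>) are divisible by the cyclotomic polynomial, and these cancel.
\<close>

lemma integral_at_poch_ratio:
  assumes "odd d" "coprime e d" "e > 0"
  shows "integral_at (cyclotomic d) (poch_ratio (ratq ^ e) k)"
proof -
  have d: "d > 0" using assms by (simp add: odd_pos)
  obtain h where h: "d = 2 * h + 1" using assms(1) by (elim oddE)
  define x where "x = ratq ^ e"
  have num: "integral_at (cyclotomic d) (1 - x ^ j)" for j
    unfolding power_mult[symmetric] x_def by (rule integral_at_one_minus_ratq_power)
  have block: "integral_at (cyclotomic d)
      (\<Prod>i<d. (1 - x ^ (2 * (a * d + i) + 1)) / (1 - x ^ (2 * (a * d + i) + 2)))" for a
  proof -
    define y where "y = x ^ d"
    have ypoly: "y = to_fract (polyq ^ (d * e))"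
      by (simp add: y_def x_def to_fract_power power_mult[symmetric] mult.commute)
    have y1: "1 - y ^ m \<noteq> 0" if "m > 0" for m
      using that assms d unfolding y_def x_def power_mult[symmetric] by (intro ratq_power_neq_1) simp
    have "(\<Prod>i<d. (1 - x ^ (2 * (a * d + i) + 1)) / (1 - x ^ (2 * (a * d + i) + 2)))
        = (\<Prod>i<d. 1 - x ^ (2 * (a * d + i) + 1)) * (\<Prod>i<d. 1 / (1 - x ^ (2 * (a * d + i) + 2)))"
      by (simp flip: prod.distrib)
    also have "(\<Prod>i<d. 1 - x ^ (2 * (a * d + i) + 1))
        = (1 - y ^ (2 * a + 1)) * (\<Prod>i\<in>{..<d} - {h}. 1 - x ^ (2 * (a * d + i) + 1))"
    proof -
      have "2 * (a * d + h) + 1 = d * (2 * a + 1)" by (simp add: h algebra_simps)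
      then have "y ^ (2 * a + 1) = x ^ (2 * (a * d + h) + 1)" by (simp only: y_def power_mult)
      then show ?thesis
        using prod.remove[of "{..<d}" h "\<lambda>i. 1 - x ^ (2 * (a * d + i) + 1)"] by (simp add: h)
    qed
    also have "(\<Prod>i<d. 1 / (1 - x ^ (2 * (a * d + i) + 2)))
        = (\<Prod>i<2 * h. 1 / (1 - x ^ (2 * (a * d + i) + 2))) * (1 / (1 - y ^ (2 * a + 2)))"
    proof -
      have "2 * (a * d + 2 * h) + 2 = d * (2 * a + 2)" by (simp add: h algebra_simps)
      then have "x ^ (2 * (a * d + 2 * h) + 2) = y ^ (2 * a + 2)" by (simp only: y_def power_mult)
      moreover have "{..<d} = insert (2 * h) {..<2 * h}" by (auto simp: h)
      ultimately show ?thesis by simp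
    qed
    also have "(1 - y ^ (2 * a + 1)) * (\<Prod>i\<in>{..<d} - {h}. 1 - x ^ (2 * (a * d + i) + 1))
         * ((\<Prod>i<2 * h. 1 / (1 - x ^ (2 * (a * d + i) + 2))) * (1 / (1 - y ^ (2 * a + 2))))
        = ((1 - y ^ (2 * a + 1)) / (1 - y ^ (2 * a + 2)))
           * ((\<Prod>i\<in>{..<d} - {h}. 1 - x ^ (2 * (a * d + i) + 1))
              * (\<Prod>i<2 * h. 1 / (1 - x ^ (2 * (a * d + i) + 2))))"
      by simp
    \<comment> \<open>The common factor \<open>1 - y\<close> carries the cyclotomic polynomial.
      Cancelling it leaves \<open>q\<close>-integers in \<open>y\<close>, and
      \<open>coprime_cyclotomic_qint\<close> makes the lower one invertible.\<close>
    also have "(1 - y ^ (2 * a + 1)) / (1 - y ^ (2 * a + 2)) = qint y (2 * a + 1) * (1 / qint y (2 * a + 2))"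
      unfolding qint_eq[symmetric] using y1[of 1] by simp
    finally have *: "(\<Prod>i<d. (1 - x ^ (2 * (a * d + i) + 1)) / (1 - x ^ (2 * (a * d + i) + 2)))
       = qint y (2 * a + 1) * (1 / qint y (2 * a + 2)) * ((\<Prod>i\<in>{..<d} - {h}. 1 - x ^ (2 * (a * d + i) + 1))
              * (\<Prod>i<2 * h. 1 / (1 - x ^ (2 * (a * d + i) + 2))))" .
    have q0: "qint (polyq ^ (d * e)) (2 * a + 2) \<noteq> 0"
    proof
      assume "qint (polyq ^ (d * e)) (2 * a + 2) = 0"
      then have "qint y (2 * a + 2) = 0" unfolding ypoly to_fract_qint[symmetric] by simp
      then show False using qint_eq[of y "2 * a + 2"] y1[of "2 * a + 2"] by simp
    qed
    have "integral_at (cyclotomic d) (1 / (1 - x ^ (2 * (a * d + i) + 2)))" if "i < 2 * h" for i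
      unfolding power_mult[symmetric] x_def
      using that assms h by (intro integral_at_inverse_one_minus[OF d] not_dvd_denominator) auto
    moreover have "integral_at (cyclotomic d) (1 / qint y (2 * a + 2))"
      unfolding ypoly to_fract_qint[symmetric]
      using q0 d by (intro integral_at_inverse coprime_cyclotomic_qint) auto
    moreover have "integral_at (cyclotomic d) (qint y (2 * a + 1))"
      unfolding ypoly to_fract_qint[symmetric] by (rule integral_at_to_fract)
    ultimately show ?thesis unfolding *
      by (intro integral_at_mult integral_at_prod num) simp_all
  qed
  have multiple: "integral_at (cyclotomic d) (poch_ratio x (a * d))" for a
  proof (induction a)
    case (Suc a)
    have "Suc a * d = a * d + d" by simp
    then show ?case using integral_at_mult[OF Suc block[of a]] by (simp only: poch_ratio_add)
  qed (simp add: poch_ratio_eq_prod)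
  have "integral_at (cyclotomic d) (poch_ratio x ((k div d) * d + k mod d))"
    unfolding poch_ratio_add
    using multiple poch_ratio_shift_cong(2)[OF assms(1,2), of "k mod d" "k div d"] d
    by (intro integral_at_mult) (simp_all add: x_def)
  then show ?thesis by (simp add: x_def)
qed

text \<open>As in Lucas' theorem, complete blocks split off and the incomplete block behaves like
  the initial one. The first factor is left unevaluated, since later only its integrality
  matters.\<close>

lemma poch_ratio_cong:
  assumes "odd d" "coprime e d" "e > 0" "r < d"
  shows "ratfun_cong (poch_ratio (ratq ^ e) (a * d + r))
    (poch_ratio (ratq ^ e) (a * d) * poch_ratio (ratq ^ e) r) (cyclotomic d)"
  unfolding poch_ratio_add
  using poch_ratio_shift_cong(1)[OF assms(1,2,4)] integral_at_poch_ratio[OF assms(1-3)]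
  by (intro ratfun_cong_mult ratfun_cong_refl)

lemma c_q_eq:
  "c_q k = (- ratq) ^ k * qint ratq (4 * k + 1) * poch_ratio ratq k ^ 4 * poch_ratio (ratq ^ 2) k"
proof -
  have "(ratq ^ 2) ^ 2 = ratq ^ 4" by (simp flip: power_mult)
  moreover have "(- ratq) ^ k = (- 1) ^ k * ratq ^ k" by (rule power_minus)
  ultimately show ?thesis by (simp add: c_q_def poch_ratio_def power_divide mult_ac)
qed

lemma integral_at_qint: "integral_at P (qint ratq m)"
  unfolding to_fract_qint[symmetric] by (rule integral_at_to_fract)

lemma integral_at_minus_ratq_power: "integral_at P ((- ratq) ^ k)"
  by (intro integral_at_power integral_at_minus integral_at_to_fract)

lemma integral_at_poch_ratio_ratq:
  assumes "odd d"
  shows "integral_at (cyclotomic d) (poch_ratio ratq k)"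
    and "integral_at (cyclotomic d) (poch_ratio (ratq ^ 2) k)"
  using integral_at_poch_ratio[OF assms, of 1] integral_at_poch_ratio[OF assms, of 2] assms
  by simp_all

lemma integral_at_c_q: "odd d \<Longrightarrow> integral_at (cyclotomic d) (c_q k)"
  unfolding c_q_eq
  by (intro integral_at_mult integral_at_minus_ratq_power integral_at_qint integral_at_power integral_at_poch_ratio_ratq)

lemma qint_ratq_cong:
  assumes "d > 1" "d dvd m"
  shows "ratfun_cong (qint ratq (i + m)) (qint ratq i) (cyclotomic d)"
proof -
  have *: "qint ratq m = (1 - ratq ^ m) * (1 / (1 - ratq ^ 1))" for m
    using qint_eq[of ratq m] ratq_power_neq_1[of 1] by (simp add: nonzero_eq_divide_eq)
  show ?thesis unfolding *
    using assms
    by (intro ratfun_cong_mult ratfun_cong_ratq_power_add ratfun_cong_refl integral_at_inverse_one_minus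
          integral_at_one_minus_ratq_power) auto
qed

text \<open>\<open>[4 k + 1]\<close> depends only on \<open>k\<close> modulo \<open>d\<close>, and
  both ratios split. The multiplier of \<open>c_q r\<close> does not involve \<open>r\<close>, which
  lets the double sum factor later.\<close>

lemma c_q_cong:
  assumes "odd d" "d > 1" "r < d"
  shows "ratfun_cong (c_q (a * d + r))
    ((- ratq) ^ (a * d) * poch_ratio ratq (a * d) ^ 4 * poch_ratio (ratq ^ 2) (a * d) * c_q r) (cyclotomic d)"
proof -
  have 1: "ratfun_cong (poch_ratio ratq (a * d + r)) (poch_ratio ratq (a * d) * poch_ratio ratq r) (cyclotomic d)"
    using poch_ratio_cong[of d 1 r a] assms by simp
  have 2: "ratfun_cong (poch_ratio (ratq ^ 2) (a * d + r)) (poch_ratio (ratq ^ 2) (a * d) * poch_ratio (ratq ^ 2) r) (cyclotomic d)"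
    using poch_ratio_cong[of d 2 r a] assms by simp
  have "4 * (a * d + r) + 1 = (4 * r + 1) + 4 * a * d" by simp
  then have 3: "ratfun_cong (qint ratq (4 * (a * d + r) + 1)) (qint ratq (4 * r + 1)) (cyclotomic d)"
    using qint_ratq_cong[of d "4 * a * d" "4 * r + 1"] assms by (simp only: dvd_triv_right simp_thms)
  have "ratfun_cong (c_q (a * d + r)) ((- ratq) ^ (a * d + r) * qint ratq (4 * r + 1)
      * (poch_ratio ratq (a * d) * poch_ratio ratq r) ^ 4
      * (poch_ratio (ratq ^ 2) (a * d) * poch_ratio (ratq ^ 2) r)) (cyclotomic d)"
    unfolding c_q_eq using assms
    by (intro ratfun_cong_mult ratfun_cong_power ratfun_cong_refl 1 2 3 integral_at_mult integral_at_minus_ratq_power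
        integral_at_qint integral_at_power integral_at_poch_ratio_ratq)
  then show ?thesis by (simp add: c_q_eq power_add power_mult_distrib mult_ac)
qed

text \<open>The numerator factor of index \<open>N\<close> in \<open>poch_ratio ratq r\<close> is
  \<open>1 - q ^ n\<close>, and for \<open>r < n\<close> all denominators are invertible. So the
  ratio is divisible by \<open>cyclotomic n\<close>, and it enters \<open>c_q\<close> with exponent
  four.\<close>

lemma c_q_cong_0:
  assumes "n = 2 * N + 1" "N < r" "r < n"
  shows "ratfun_cong (c_q r) 0 (cyclotomic n ^ 3)"
proof -
  have n: "odd n" "n > 0" using assms by simp_all
  define f where "f i = (1 - ratq ^ (2 * i + 1)) / (1 - ratq ^ (2 * i + 2))" for i
  have den: "integral_at (cyclotomic n) (1 / (1 - ratq ^ (2 * i + 2)))" if "i < r" for i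
    using not_dvd_denominator[OF n(1), of 1 i 0] that assms
    by (intro integral_at_inverse_one_minus[OF n(2)]) simp_all
  have int: "integral_at (cyclotomic n) (f i)" if "i < r" for i
    using integral_at_mult[OF integral_at_one_minus_ratq_power den[OF that], of "2 * i + 1"]
    by (simp add: f_def)
  have "ratfun_cong ((1 - ratq ^ (2 * N + 1)) * (1 / (1 - ratq ^ (2 * N + 2))))
      (0 * (1 / (1 - ratq ^ (2 * N + 2)))) (cyclotomic n)"
    using n assms(1,2)
    by (intro ratfun_cong_mult ratfun_cong_one_minus_ratq_power ratfun_cong_refl
        integral_at_one_minus_ratq_power den) simp_all
  then have "ratfun_cong (f N) 0 (cyclotomic n)" by (simp add: f_def)
  then have "ratfun_cong (f N * (\<Prod>i\<in>{..<r} - {N}. f i)) (0 * (\<Prod>i\<in>{..<r} - {N}. f i)) (cyclotomic n)"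
    using assms(2) by (intro ratfun_cong_mult ratfun_cong_refl int integral_at_prod) auto
  moreover have "poch_ratio ratq r = f N * (\<Prod>i\<in>{..<r} - {N}. f i)"
    unfolding poch_ratio_eq_prod f_def[symmetric] using assms(2) by (simp add: prod.remove)
  ultimately obtain X where X: "integral_at (cyclotomic n) X" "poch_ratio ratq r = to_fract (cyclotomic n) * X"
    unfolding ratfun_cong_iff by auto
  \<comment> \<open>Three of the four cyclotomic factors form the modulus; the fourth stays in the
    cofactor.\<close>
  have "c_q r - 0 = to_fract (cyclotomic n) ^ 3 * (to_fract (cyclotomic n) * ((- ratq) ^ r * qint ratq (4 * r + 1)
     * X ^ 4 * poch_ratio (ratq ^ 2) r))"
    unfolding c_q_eq X by (simp add: power_mult_distrib power3_eq_cube power4_eq_xxxx mult_ac)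
  moreover have "integral_at (cyclotomic n) (to_fract (cyclotomic n) * ((- ratq) ^ r * qint ratq (4 * r + 1)
     * X ^ 4 * poch_ratio (ratq ^ 2) r))"
    using n X(1) by (intro integral_at_mult integral_at_to_fract integral_at_minus_ratq_power
        integral_at_qint integral_at_power integral_at_poch_ratio_ratq)
  ultimately show ?thesis by (intro ratfun_congI) auto
qed

section \<open>Shifting one pair of factors by \<open>n\<close> and summing exactly\<close>

lemma shifted_ratio_eq_prod:
  "shifted_ratio q n k = (\<Prod>i<k. (1 - q ^ (2 * i + 1 + n)) * (1 - q ^ (2 * i + 1) / q ^ n)
      / ((1 - q ^ (2 * i + 2 + n)) * (1 - q ^ (2 * i + 2) / q ^ n)))"
proof -
  have "q ^ (2 * i + 1 + n) = q ^ (n + 1) * (q ^ 2) ^ i" "q ^ (2 * i + 1) / q ^ n = q / q ^ n * (q ^ 2) ^ i"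
    "q ^ (2 * i + 2 + n) = q ^ (n + 2) * (q ^ 2) ^ i" "q ^ (2 * i + 2) / q ^ n = q ^ 2 / q ^ n * (q ^ 2) ^ i" for i
    unfolding power_mult[of q 2 i, symmetric] by (simp_all add: power2_eq_square power_add mult_ac)
  then show ?thesis unfolding shifted_ratio_def qpoch_def prod_dividef prod.distrib by (simp only:)
qed

text \<open>With \<open>x = q ^ j\<close> the two sides differ by
  \<open>- x * q^(-n) * (1 - q ^ n)^2\<close>: the opposite shifts cancel to first order.\<close>

lemma one_minus_pair_cong:
  assumes "n > 0"
  shows "ratfun_cong ((1 - ratq ^ (j + n)) * (1 - ratq ^ j / ratq ^ n)) ((1 - ratq ^ j) ^ 2) (cyclotomic n ^ 2)"
proof -
  obtain X where X: "integral_at (cyclotomic n) X" "1 - ratq ^ n = to_fract (cyclotomic n) * X"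
    using ratfun_cong_one_minus_ratq_power[OF assms dvd_refl] unfolding ratfun_cong_iff by auto
  have "(1 - ratq ^ (j + n)) * (1 - ratq ^ j / ratq ^ n) - (1 - ratq ^ j) ^ 2
     = - (ratq ^ j * (1 / ratq ^ n)) * (1 - ratq ^ n) ^ 2"
    by (simp add: field_simps power2_eq_square power_add)
  also have "\<dots> = to_fract (cyclotomic n) ^ 2 * (- (ratq ^ j * (1 / ratq ^ n)) * X ^ 2)"
    unfolding X by (simp add: power_mult_distrib)
  finally show ?thesis
    using assms X(1)
    by (intro ratfun_congI[where X = "- (ratq ^ j * (1 / ratq ^ n)) * X ^ 2"] integral_at_mult integral_at_minus
        integral_at_power integral_at_ratq_power integral_at_inverse_ratq_power) simp_all
qed

text \<open>The bound \<open>k <= N\<close> keeps the exponents \<open>2 i + 2\<close> below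
  \<open>n\<close>, so that all denominators, shifted or not, are invertible.\<close>

lemma shifted_ratio_cong:
  assumes "n = 2 * N + 1" "k \<le> N"
  shows "ratfun_cong (shifted_ratio ratq n k) (poch_ratio ratq k ^ 2) (cyclotomic n ^ 2)"
    and "integral_at (cyclotomic n) (shifted_ratio ratq n k)"
proof -
  have n: "n > 0" using assms by simp
  define A where "A j = (1 - ratq ^ (j + n)) * (1 - ratq ^ j / ratq ^ n)" for j
  define B where "B j = (1 - ratq ^ j) ^ 2" for j
  have cong: "ratfun_cong (A j) (B j) (cyclotomic n ^ 2)" for j
    unfolding A_def B_def by (rule one_minus_pair_cong[OF n])
  have intA: "integral_at (cyclotomic n) (A j)" for j
    using integral_at_mult[OF integral_at_ratq_power[of _ j] integral_at_inverse_ratq_power[OF n, of n]]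
    unfolding A_def by (intro integral_at_mult integral_at_diff integral_at_ratq_power) simp_all
  have intB: "integral_at (cyclotomic n) (B j)" for j
    unfolding B_def by (intro integral_at_power integral_at_one_minus_ratq_power)
  have invB: "integral_at (cyclotomic n) (1 / B j)" if "0 < j" "j < n" for j
  proof -
    have "integral_at (cyclotomic n) ((1 / (1 - ratq ^ j)) ^ 2)"
      using that n by (intro integral_at_power integral_at_inverse_one_minus) (auto dest: dvd_imp_le)
    then show ?thesis by (simp add: B_def power_one_over)
  qed
  \<comment> \<open>The negative exponent \<open>j - n\<close> is traded for \<open>n - j\<close>,
    so that inverses of \<open>A j\<close> come under
    \<open>integral_at_inverse_one_minus\<close>.\<close>
  have A_eq: "A j = - ((1 - ratq ^ (j + n)) * (1 - ratq ^ (n - j))) * (1 / ratq ^ (n - j))" if "j < n" for j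
  proof -
    have "ratq ^ n = ratq ^ j * ratq ^ (n - j)" using that by (simp flip: power_add)
    then show ?thesis unfolding A_def by (simp add: field_simps)
  qed
  have invA: "integral_at (cyclotomic n) (1 / A j)" if "0 < j" "j < n" for j
  proof -
    have "1 / A j = - (1 / (1 - ratq ^ (j + n)) * (1 / (1 - ratq ^ (n - j)))) * ratq ^ (n - j)"
      unfolding A_eq[OF that(2)] by simp
    moreover have "\<not> n dvd j + n" "\<not> n dvd n - j" using that by (auto dest: dvd_imp_le)
    ultimately show ?thesis using n
      by (simp only: integral_at_mult integral_at_minus integral_at_inverse_one_minus integral_at_ratq_power simp_thms)
  qed
  have nzB: "B j \<noteq> 0" if "0 < j" for j using ratq_power_neq_1[OF that] by (simp add: B_def)
  have nzA: "A j \<noteq> 0" if "0 < j" "j < n" for j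
    unfolding A_eq[OF that(2)] using ratq_power_neq_1[of "j + n"] ratq_power_neq_1[of "n - j"] that by simp
  note P2 = integral_at_power_iff[of 2, simplified]
  have S: "shifted_ratio ratq n k = (\<Prod>i<k. A (2 * i + 1) * (1 / A (2 * i + 2)))"
    unfolding shifted_ratio_eq_prod A_def by simp
  have T: "poch_ratio ratq k ^ 2 = (\<Prod>i<k. B (2 * i + 1) * (1 / B (2 * i + 2)))"
    unfolding poch_ratio_eq_prod B_def prod_power_distrib by (simp add: power_divide)
  have rng: "0 < 2 * i + 2" "2 * i + 2 < n" if "i < k" for i using that assms by simp_all
  show "ratfun_cong (shifted_ratio ratq n k) (poch_ratio ratq k ^ 2) (cyclotomic n ^ 2)"
    unfolding S T
    by (intro ratfun_cong_prod ratfun_cong_mult ratfun_cong_inverse cong)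
       (use rng in \<open>simp_all only: P2 intA intB invA invB nzA nzB integral_at_mult lessThan_iff not_False_eq_True\<close>)
  show "integral_at (cyclotomic n) (shifted_ratio ratq n k)"
    unfolding S by (intro integral_at_prod integral_at_mult intA invA) (use rng in auto)
qed

text \<open>For odd \<open>n = 2 N + 1\<close> this is the value in \<open>watson_andrews\<close> at
  \<open>ratq\<close>, as \<open>N\<close> is even exactly when \<open>n mod 4 = 1\<close>. Its
  square is the right-hand side of the theorem.\<close>

definition half_sum :: "nat \<Rightarrow> rat poly fract"
  where "half_sum n = (if n mod 4 = 1 then qint ratq n * poch_ratio (ratq ^ 2) ((n - 1) div 4) ^ 2 else 0)"

text \<open>In each term one of the two squares of \<open>poch_ratio ratq k\<close> is replaced by
  \<open>shifted_ratio\<close>; by \<open>watson_andrews\<close> the new sum equals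
  \<open>half_sum n\<close> exactly.\<close>

lemma sum_c_q_cong:
  assumes "n = 2 * N + 1"
  shows "ratfun_cong (\<Sum>k\<le>N. c_q k) (half_sum n) (cyclotomic n ^ 2)"
proof -
  have n: "odd n" "n > 0" using assms by simp_all
  have eq: "half_sum n = (\<Sum>k\<le>N. (- ratq) ^ k * qint ratq (4 * k + 1) * poch_ratio ratq k ^ 2
       * shifted_ratio ratq n k * poch_ratio (ratq ^ 2) k)"
  proof -
    have "ratq ^ Suc i \<noteq> 1" for i using ratq_power_neq_1[of "Suc i"] by simp
    moreover have "n mod 4 = 1 \<longleftrightarrow> even N" "(n - 1) div 4 = N div 2" unfolding assms by presburger+
    ultimately show ?thesis
      by (subst watson_andrews[OF ratq_nonzero _ assms]) (simp_all add: half_sum_def)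
  qed
  note P2 = integral_at_power_iff[of 2, simplified]
  show ?thesis unfolding eq
  proof (rule ratfun_cong_sum)
    fix k assume "k \<in> {..N}"
    then have k: "k \<le> N" by simp
    have "c_q k = (- ratq) ^ k * qint ratq (4 * k + 1) * poch_ratio ratq k ^ 2
        * poch_ratio ratq k ^ 2 * poch_ratio (ratq ^ 2) k"
      unfolding c_q_eq by (simp add: power2_eq_square power4_eq_xxxx mult_ac)
    moreover have "ratfun_cong ((- ratq) ^ k * qint ratq (4 * k + 1) * poch_ratio ratq k ^ 2
        * poch_ratio ratq k ^ 2 * poch_ratio (ratq ^ 2) k)
       ((- ratq) ^ k * qint ratq (4 * k + 1) * poch_ratio ratq k ^ 2
        * shifted_ratio ratq n k * poch_ratio (ratq ^ 2) k) (cyclotomic n ^ 2)"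
      using n
      by (intro ratfun_cong_mult ratfun_cong_refl ratfun_cong_sym[OF shifted_ratio_cong(1)[OF assms k]];
          simp only: P2 integral_at_mult integral_at_minus_ratq_power integral_at_qint integral_at_power
            integral_at_poch_ratio_ratq shifted_ratio_cong(2)[OF assms k])
    ultimately show "ratfun_cong (c_q k) ((- ratq) ^ k * qint ratq (4 * k + 1) * poch_ratio ratq k ^ 2
        * shifted_ratio ratq n k * poch_ratio (ratq ^ 2) k) (cyclotomic n ^ 2)" by simp
  qed
qed

lemma integral_at_half_sum: "odd d \<Longrightarrow> integral_at (cyclotomic d) (half_sum n)"
  unfolding half_sum_def by (simp add: integral_at_mult integral_at_qint integral_at_power integral_at_poch_ratio_ratq)

text \<open>\<open>[n]\<close> is congruent to \<open>[0] = 0\<close>, and its cofactor is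
  integral.\<close>

lemma half_sum_cong_0:
  assumes "odd d" "d > 1" "d dvd n"
  shows "ratfun_cong (half_sum n) 0 (cyclotomic d)"
proof -
  have "ratfun_cong (qint ratq n * poch_ratio (ratq ^ 2) ((n - 1) div 4) ^ 2)
     (qint ratq 0 * poch_ratio (ratq ^ 2) ((n - 1) div 4) ^ 2) (cyclotomic d)"
    using assms qint_ratq_cong[OF assms(2,3), of 0]
    by (intro ratfun_cong_mult ratfun_cong_refl integral_at_qint integral_at_power integral_at_poch_ratio_ratq) simp_all
  then show ?thesis by (simp add: half_sum_def qint_def)
qed

section \<open>The double sum as a sum over a triangle of index pairs\<close>

lemma triangle_sum: "(\<Sum>k = 0..n - 1. \<Sum>j = 0..k. f j * f (k - j)) = (\<Sum>(i, j) | i + j < n. f i * f j)"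
  if "n > 0" for f :: "nat \<Rightarrow> 'a::comm_semiring_1"
proof -
  have "{0..n - 1} = {..<n}" using that by auto
  then show ?thesis by (simp add: sum.triangle_reindex atLeast0AtMost)
qed

lemma finite_triangle: "finite {(i, j). i + j < (n::nat)}"
  by (rule finite_subset[of _ "{..<n} \<times> {..<n}"]) auto

lemma double_sum_cong_cube:
  assumes "odd n" "n > 1"
  shows "ratfun_cong (\<Sum>k = 0..n - 1. \<Sum>j = 0..k. c_q j * c_q (k - j)) (half_sum n ^ 2) (cyclotomic n ^ 3)"
proof -
  obtain N where N: "n = 2 * N + 1" using assms(1) by (elim oddE)
  note P3 = integral_at_power_iff[of 3, simplified]
  have int: "integral_at (cyclotomic n ^ 3) (c_q i)" for i using integral_at_c_q[OF assms(1)] by (simp add: P3)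
  \<comment> \<open>The square fits into the triangle because \<open>2 N < n\<close>. Every other
    pair has an index strictly between \<open>N\<close> and \<open>n\<close>, where
    \<open>c_q_cong_0\<close> applies.\<close>
  have "ratfun_cong (\<Sum>(i, j) | i + j < n. c_q i * c_q j) (\<Sum>(i, j)\<in>{..N} \<times> {..N}. c_q i * c_q j) (cyclotomic n ^ 3)"
  proof (rule ratfun_cong_sum_subset[OF finite_triangle])
    show "{..N} \<times> {..N} \<subseteq> {(i, j). i + j < n}" by (auto simp: N)
    fix p assume "p \<in> {(i, j). i + j < n} - {..N} \<times> {..N}"
    then obtain i j where p: "p = (i, j)" "i < n" "j < n" "N < i \<or> N < j" by (cases p) auto
    have "ratfun_cong (c_q i * c_q j) 0 (cyclotomic n ^ 3)"
    proof (cases "N < i")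
      case True
      have "ratfun_cong (c_q i * c_q j) (0 * c_q j) (cyclotomic n ^ 3)"
        using c_q_cong_0[OF N True p(2)] int by (intro ratfun_cong_mult ratfun_cong_refl)
      then show ?thesis by simp
    next
      case False
      then have "N < j" using p by simp
      then have "ratfun_cong (c_q i * c_q j) (c_q i * 0) (cyclotomic n ^ 3)"
        using c_q_cong_0[OF N _ p(3)] int by (intro ratfun_cong_mult ratfun_cong_refl) simp_all
      then show ?thesis by simp
    qed
    then show "ratfun_cong (case p of (i, j) \<Rightarrow> c_q i * c_q j) 0 (cyclotomic n ^ 3)" by (simp add: p)
  qed
  also have "(\<Sum>(i, j)\<in>{..N} \<times> {..N}. c_q i * c_q j) = (\<Sum>k\<le>N. c_q k) ^ 2"
    by (simp add: power2_eq_square sum_product sum.cartesian_product)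
  also have "ratfun_cong \<dots> (half_sum n ^ 2) (cyclotomic n ^ 3)"
  proof -
    \<comment> \<open>With \<open>t\<close> for the cyclotomic polynomial, the sum is
      \<open>t Y + t^2 X\<close> and its target \<open>t Y\<close>. The squares differ by
      \<open>t^3 X (2 Y + t X)\<close>, which gains one power of \<open>t\<close>.\<close>
    obtain X where X: "integral_at (cyclotomic n) X" "(\<Sum>k\<le>N. c_q k) - half_sum n = to_fract (cyclotomic n) ^ 2 * X"
      using sum_c_q_cong[OF N] ratfun_cong_power_iff[of 2] by auto
    obtain Y where Y: "integral_at (cyclotomic n) Y" "half_sum n = to_fract (cyclotomic n) * Y"
      using half_sum_cong_0[OF assms dvd_refl] unfolding ratfun_cong_iff by auto
    define t where "t = to_fract (cyclotomic n)"
    have S: "(\<Sum>k\<le>N. c_q k) = t * Y + t ^ 2 * X" using X Y unfolding t_def by (simp add: algebra_simps)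
    have "(\<Sum>k\<le>N. c_q k) ^ 2 - half_sum n ^ 2 = t ^ 3 * (X * (Y + Y + t * X))"
      unfolding S Y(2) t_def[symmetric] by (simp add: algebra_simps power2_eq_square power3_eq_cube)
    moreover have "integral_at (cyclotomic n) (X * (Y + Y + t * X))"
      unfolding t_def by (intro integral_at_mult integral_at_add X Y integral_at_to_fract)
    ultimately show ?thesis unfolding t_def by (intro ratfun_congI) auto
  qed
  finally show ?thesis unfolding triangle_sum[OF odd_pos[OF assms(1)]] .
qed

lemma double_sum_cong_0:
  assumes "odd d" "d > 1" "n = m * d" "m > 0"
  shows "ratfun_cong (\<Sum>k = 0..n - 1. \<Sum>j = 0..k. c_q j * c_q (k - j)) 0 (cyclotomic d)"
proof -
  obtain h where h: "d = 2 * h + 1" using assms(1) by (elim oddE)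
  have n: "n > 0" using assms by simp
  define B where "B = {(i, j). i + j < n \<and> i mod d \<le> h \<and> j mod d \<le> h}"
  define C where "C a = (- ratq) ^ (a * d) * poch_ratio ratq (a * d) ^ 4 * poch_ratio (ratq ^ 2) (a * d)" for a
  have int: "integral_at (cyclotomic d) (c_q i)" for i using integral_at_c_q[OF assms(1)] .
  have intC: "integral_at (cyclotomic d) (C a)" for a
    unfolding C_def using assms(1)
    by (intro integral_at_mult integral_at_minus_ratq_power integral_at_power integral_at_poch_ratio_ratq)
  have cong: "ratfun_cong (c_q (a * d + r)) (C a * c_q r) (cyclotomic d)" if "r < d" for a r
    unfolding C_def by (rule c_q_cong[OF assms(1,2) that])
  have cong0: "ratfun_cong (c_q i) 0 (cyclotomic d)" if "h < i mod d" for i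
  proof -
    have lt: "i mod d < d" using assms by simp
    have "ratfun_cong (c_q (i div d * d + i mod d)) (C (i div d) * c_q (i mod d)) (cyclotomic d)"
      by (rule cong[OF lt])
    moreover have "ratfun_cong (c_q (i mod d)) 0 (cyclotomic d)"
      using c_q_cong_0[OF h that lt] by (rule ratfun_cong_dvd) simp
    then have "ratfun_cong (C (i div d) * c_q (i mod d)) (C (i div d) * 0) (cyclotomic d)"
      by (intro ratfun_cong_mult ratfun_cong_refl intC) simp_all
    ultimately have "ratfun_cong (c_q (i div d * d + i mod d)) (C (i div d) * 0) (cyclotomic d)"
      by (rule ratfun_cong_trans)
    then show ?thesis by simp
  qed
  have "ratfun_cong (\<Sum>(i, j) | i + j < n. c_q i * c_q j) (\<Sum>(i, j)\<in>B. c_q i * c_q j) (cyclotomic d)"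
  proof (rule ratfun_cong_sum_subset[OF finite_triangle])
    show "B \<subseteq> {(i, j). i + j < n}" by (auto simp: B_def)
    fix p assume "p \<in> {(i, j). i + j < n} - B"
    then obtain i j where p: "p = (i, j)" "h < i mod d \<or> h < j mod d" by (cases p) (auto simp: B_def not_le)
    have "ratfun_cong (c_q i * c_q j) 0 (cyclotomic d)"
    proof (cases "h < i mod d")
      case True
      have "ratfun_cong (c_q i * c_q j) (0 * c_q j) (cyclotomic d)"
        using cong0[OF True] int by (intro ratfun_cong_mult ratfun_cong_refl)
      then show ?thesis by simp
    next
      case False
      then have "h < j mod d" using p by simp
      then have "ratfun_cong (c_q i * c_q j) (c_q i * 0) (cyclotomic d)"
        using cong0 int by (intro ratfun_cong_mult ratfun_cong_refl) simp_all
      then show ?thesis by simp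
    qed
    then show "ratfun_cong (case p of (i, j) \<Rightarrow> c_q i * c_q j) 0 (cyclotomic d)" by (simp add: p)
  qed
  \<comment> \<open>Both indices are divided by \<open>d\<close> with remainder. Since
    \<open>r + s <= 2 h < d\<close>, the condition \<open>i + j < n\<close> becomes
    \<open>a + b < m\<close> and no longer ties the quotients to the residues.\<close>
  also have "(\<Sum>(i, j)\<in>B. c_q i * c_q j)
      = (\<Sum>((a, b), (r, s))\<in>{(a, b). a + b < m} \<times> ({..h} \<times> {..h}). c_q (a * d + r) * c_q (b * d + s))"
  proof (rule sum.reindex_bij_witness[where j = "\<lambda>(i, j). ((i div d, j div d), (i mod d, j mod d))"
        and i = "\<lambda>((a, b), (r, s)). (a * d + r, b * d + s)"])
    fix p assume "p \<in> B"
    then obtain i j where p: "p = (i, j)" "i + j < n" "i mod d \<le> h" "j mod d \<le> h" by (auto simp: B_def)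
    have "(i div d + j div d) * d \<le> i + j"
      unfolding distrib_right by (intro add_mono div_times_less_eq_dividend)
    then have "(i div d + j div d) * d < m * d" using p(2) unfolding assms(3) by (rule le_less_trans)
    then have "i div d + j div d < m" by simp
    then show "(case p of (i, j) \<Rightarrow> ((i div d, j div d), (i mod d, j mod d))) \<in> {(a, b). a + b < m} \<times> ({..h} \<times> {..h})"
      using p by simp
  next
    fix p assume "p \<in> {(a, b). a + b < m} \<times> ({..h} \<times> {..h})"
    then obtain a b r s where p: "p = ((a, b), (r, s))" "a + b < m" "r \<le> h" "s \<le> h" by auto
    then have rd: "r < d" "s < d" using h by simp_all
    have "(a + b + 1) * d \<le> m * d" using p by (intro mult_right_mono) auto
    then have "a * d + r + (b * d + s) < n" using p h assms by (simp add: algebra_simps)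
    then show "(\<lambda>((a, b), (r, s)). (a * d + r, b * d + s)) p \<in> B"
      using p rd by (simp add: B_def)
    show "(\<lambda>(i, j). ((i div d, j div d), (i mod d, j mod d)))
        ((\<lambda>((a, b), (r, s)). (a * d + r, b * d + s)) p) = p"
      using p rd by simp
  qed auto
  also have "ratfun_cong \<dots> (\<Sum>((a, b), (r, s))\<in>{(a, b). a + b < m} \<times> ({..h} \<times> {..h}).
      (C a * c_q r) * (C b * c_q s)) (cyclotomic d)"
  proof (rule ratfun_cong_sum)
    fix p assume "p \<in> {(a, b). a + b < m} \<times> ({..h} \<times> {..h})"
    then obtain a b r s where p: "p = ((a, b), (r, s))" "r < d" "s < d" using h by auto
    have "ratfun_cong (c_q (a * d + r) * c_q (b * d + s)) ((C a * c_q r) * (C b * c_q s)) (cyclotomic d)"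
      using p by (intro ratfun_cong_mult cong int integral_at_mult intC)
    then show "ratfun_cong ((\<lambda>((a, b), (r, s)). c_q (a * d + r) * c_q (b * d + s)) p)
        ((\<lambda>((a, b), (r, s)). (C a * c_q r) * (C b * c_q s)) p) (cyclotomic d)" by (simp add: p)
  qed
  also have "(\<Sum>((a, b), (r, s))\<in>{(a, b). a + b < m} \<times> ({..h} \<times> {..h}). (C a * c_q r) * (C b * c_q s))
      = (\<Sum>(a, b) | a + b < m. C a * C b) * (\<Sum>r\<le>h. c_q r) ^ 2"
    unfolding power2_eq_square sum_product sum.cartesian_product
    by (rule sum.cong) (auto simp: mult_ac)
  \<comment> \<open>Here \<open>sum_c_q_cong\<close> is used with \<open>d\<close> in place of
    \<open>n\<close>; \<open>half_sum d\<close> vanishes modulo \<open>cyclotomic d\<close>.\<close>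
  also have "ratfun_cong \<dots> ((\<Sum>(a, b) | a + b < m. C a * C b) * 0 ^ 2) (cyclotomic d)"
  proof -
    have "ratfun_cong (\<Sum>r\<le>h. c_q r) (half_sum d) (cyclotomic d)"
      using sum_c_q_cong[OF h] by (rule ratfun_cong_dvd) simp
    also have "ratfun_cong (half_sum d) 0 (cyclotomic d)" by (rule half_sum_cong_0[OF assms(1,2) dvd_refl])
    finally have "ratfun_cong ((\<Sum>r\<le>h. c_q r) ^ 2) (0 ^ 2) (cyclotomic d)"
      by (intro ratfun_cong_power integral_at_sum int) simp_all
    then show ?thesis
      by (intro ratfun_cong_mult ratfun_cong_refl integral_at_sum) (auto intro: integral_at_mult intC)
  qed
  finally show ?thesis unfolding triangle_sum[OF n] by simp
qed

theorem theorem5p3: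
  fixes n :: nat
  assumes "n > 0" and "odd n"
  shows "ratfun_cong
    (\<Sum>k = 0..n - 1. \<Sum>j = 0..k. c_q j * c_q (k - j))
    (if n mod 4 = 1
     then (qint ratq n) ^ 2
       * ((qpoch (ratq ^ 2) (ratq ^ 4) ((n - 1) div 4)) ^ 4
          / (qpoch (ratq ^ 4) (ratq ^ 4) ((n - 1) div 4)) ^ 4)
     else 0)
    (qint polyq n * (cyclotomic n) ^ 2)"
proof -
  let ?S = "\<Sum>k = 0..n - 1. \<Sum>j = 0..k. c_q j * c_q (k - j)"
  have sq: "(x * y ^ 2) ^ 2 = x ^ 2 * y ^ 4" for x y :: "rat poly fract"
    by (simp add: power2_eq_square power4_eq_xxxx mult_ac)
  have "(ratq ^ 2) ^ 2 = ratq ^ 4" by (simp flip: power_mult)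
  then have pr: "poch_ratio (ratq ^ 2) m = qpoch (ratq ^ 2) (ratq ^ 4) m / qpoch (ratq ^ 4) (ratq ^ 4) m" for m
    by (simp only: poch_ratio_def)
  have "half_sum n ^ 2 = (if n mod 4 = 1
      then qint ratq n ^ 2 * poch_ratio (ratq ^ 2) ((n - 1) div 4) ^ 4 else 0)"
    by (simp add: half_sum_def sq)
  then have rhs: "(if n mod 4 = 1
     then (qint ratq n) ^ 2
       * ((qpoch (ratq ^ 2) (ratq ^ 4) ((n - 1) div 4)) ^ 4
          / (qpoch (ratq ^ 4) (ratq ^ 4) ((n - 1) div 4)) ^ 4)
     else 0) = half_sum n ^ 2"
    unfolding pr power_divide by (rule sym)
  have "ratfun_cong ?S (half_sum n ^ 2) (qint polyq n * (cyclotomic n) ^ 2)"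
  proof (cases "n = 1")
    \<comment> \<open>For \<open>n = 1\<close> both sides are equal. The other case relies on
      \<open>n > 1\<close>, which makes \<open>cyclotomic n\<close> a factor of
      \<open>[n]\<close>.\<close>
    case True
    have "c_q 0 = 1" by (simp add: c_q_def qint_def)
    moreover have "half_sum 1 = 1" by (simp add: half_sum_def qint_def poch_ratio_def)
    ultimately have "?S = half_sum n ^ 2" using True by simp
    then show ?thesis by (simp only: ratfun_cong_refl)
  next
    case False
    with assms have n: "n > 1" by simp
    define D where "D = {d. d dvd n \<and> d \<noteq> 1 \<and> d \<noteq> n}"
    have fin: "finite D" using assms by (auto simp: D_def intro: finite_subset[of _ "{d. d dvd n}"])
    have D: "odd d" "d > 1" "d dvd n" "d \<noteq> n" if "d \<in> D" for d
    proof -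
      show "d dvd n" "d \<noteq> n" using that by (simp_all add: D_def)
      then show "odd d" using assms(2) dvd_trans by blast
      then show "d > 1" using that by (cases d) (auto simp: D_def)
    qed
    have "{d. d dvd n \<and> d \<noteq> 1} = insert n D" using n by (auto simp: D_def)
    then have "qint polyq n = cyclotomic n * (\<Prod>d\<in>D. cyclotomic d)"
      unfolding qint_eq_prod_cyclotomic[OF assms(1)] using fin by (simp add: D_def)
    \<comment> \<open>\<open>[n]\<close> contributes the third copy of \<open>cyclotomic n\<close>,
      and one copy of \<open>cyclotomic d\<close> for each proper divisor
      \<open>d > 1\<close>.\<close>
    then have modulus: "qint polyq n * (cyclotomic n) ^ 2 = cyclotomic n ^ 3 * (\<Prod>d\<in>D. cyclotomic d)"
      by (simp add: power2_eq_square power3_eq_cube mult_ac)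
    have cube: "ratfun_cong ?S (half_sum n ^ 2) (cyclotomic n ^ 3)"
      by (rule double_sum_cong_cube[OF assms(2) n])
    \<comment> \<open>Both sides vanish modulo \<open>cyclotomic d\<close>: the double sum by
      \<open>double_sum_cong_0\<close>, the right side through its factor
      \<open>[n]\<close>.\<close>
    have small: "ratfun_cong ?S (half_sum n ^ 2) (cyclotomic d)" if dD: "d \<in> D" for d
    proof -
      obtain m where m: "n = m * d" using D(3)[OF dD] by (metis dvd_div_mult_self)
      have "ratfun_cong ?S 0 (cyclotomic d)"
        by (rule double_sum_cong_0[OF D(1,2)[OF dD] m]) (use m assms(1) in \<open>cases m, simp_all\<close>)
      moreover have "ratfun_cong (half_sum n ^ 2) (0 ^ 2) (cyclotomic d)"
        using D[OF dD] by (intro ratfun_cong_power half_sum_cong_0 integral_at_half_sum) simp_all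
      then have "ratfun_cong 0 (half_sum n ^ 2) (cyclotomic d)"
        unfolding zero_power2 by (rule ratfun_cong_sym)
      ultimately show ?thesis by (rule ratfun_cong_trans)
    qed
    have "ratfun_cong ?S (half_sum n ^ 2) (\<Prod>d\<in>D. cyclotomic d)"
    proof (rule ratfun_cong_coprime_prod[OF fin small])
      fix d e assume "d \<in> D" "e \<in> D" "d \<noteq> e"
      then show "coprime (cyclotomic d) (cyclotomic e)"
        using D(2)[of d] D(2)[of e] by (intro coprime_cyclotomics) simp_all
    next
      show "ratfun_cong ?S (half_sum n ^ 2) 1"
        using cube by (rule ratfun_cong_dvd) simp
    qed
    moreover have "coprime (cyclotomic n ^ 3) (\<Prod>d\<in>D. cyclotomic d)"
    proof (intro prod_coprime_right)
      fix d assume "d \<in> D"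
      then have "coprime (cyclotomic n) (cyclotomic d)"
        using D(2,4)[of d] assms(1) by (intro coprime_cyclotomics) auto
      then show "coprime (cyclotomic n ^ 3) (cyclotomic d)" by (simp add: coprime_power_left_iff)
    qed
    ultimately show ?thesis unfolding modulus by (intro ratfun_cong_coprime_mult cube)
  qed
  then show ?thesis unfolding rhs .
qed

end
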